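(* Let the Finsler space $(M,F)$, $\dim M=N\ge3$, be conformally automorphic to the Riemannian space $(M,S)$, $S=\sqrt{a_{mn}y^my^n}$, with degree $H=H(x)>0$, through the transformation $t=t(x,y)$. Then for any two nonzero tangent vectors $y_1,y_2\in T_xM$ the Finslerian angle is $$\alpha_{\{x\}}(y_1,y_2)=\frac1{H(x)}\arccos\lambda,\qquad \lambda=\frac{a_{mn}(x)\,t_1^m t_2^n}{S_1S_2},$$ where $t_1^m=t^m(x,y_1)$, $t_2^m=t^m(x,y_2)$, $S_1=\sqrt{a_{mn}(x)t_1^mt_1^n}$, $S_2=\sqrt{a_{mn}(x)t_2^mt_2^n}$.
   Context: $M$ is a $C^\infty$ manifold with local coordinates $x^i$; $y^i$ are the induced coordinates of tangent vectors $y\in T_xM\setminus0$; repeated indices are summed over $1,\dots,N$. The Finsler metric function $F(x,y)$ is smooth, positive, positively homogeneous of degree 1 in $y$, with positive-definite $g_{ij}=\frac12\,\partial^2F^2/\partial y^i\partial y^j$. Definition. $(M,F)$ is conformally automorphic to $(M,S)$, of degree $H=H(x)>0$, if there is a smooth family of invertible smooth transformations $y\mapsto t=t(x,y)$ of nonzero tangent vectors at $x$ into nonzero tangent vectors at the same $x$ such that: (i) $t^m(x,ky)=k^{H}t^m(x,y)$ for all $k>0$; (ii) $F(x,y)=1\iff S(x,t(x,y))=1$; (iii) $g_{mn}(x,y)=p^2\,a_{ij}(x)\,t^i_m t^j_n$, where $t^i_m=\partial t^i/\partial y^m$ and $p=p(x,y)>0$. The Finslerian angle $\alpha_{\{x\}}(y_1,y_2)$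 between nonzero $y_1,y_2\in T_xM$ is the length of the geodesic arc joining the points $y_1/F(x,y_1)$ and $y_2/F(x,y_2)$ on the indicatrix $\{y\in T_xM:F(x,y)=1\}$, the latter carrying the Riemannian metric induced by $g_{ij}(x,y)\,dy^idy^j$. *)

theory Defs
  imports "HOL-Analysis.Analysis"
begin

section \<open>Smooth maps between normed spaces\<close>

text \<open>Meant for open sets \<open>S\<close>.\<close>

primrec C_k_on ::
  "nat \<Rightarrow> ('a::real_normed_vector \<Rightarrow> 'b::real_normed_vector) \<Rightarrow> 'a set \<Rightarrow> bool"
where
  "C_k_on 0 f S \<longleftrightarrow> continuous_on S f"
| "C_k_on (Suc k) f S \<longleftrightarrow>
     (\<forall>x\<in>S. f differentiable (at x)) \<and>
     (\<forall>v. C_k_on k (\<lambda>x. frechet_derivative f (at x) v) S)"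

definition smooth_on ::
  "'a::real_normed_vector set \<Rightarrow> ('a \<Rightarrow> 'b::real_normed_vector) \<Rightarrow> bool"
where
  "smooth_on S f \<longleftrightarrow> (\<forall>k. C_k_on k f S)"

section \<open>Smooth manifolds and tangent vectors\<close>

type_synonym ('m, 'n) chart = "'m set \<times> ('m \<Rightarrow> real^'n)"

definition is_chart :: "'m topology \<Rightarrow> ('m, 'n::finite) chart \<Rightarrow> bool"
where
  "is_chart M c \<longleftrightarrow>
     openin M (fst c) \<and> open (snd c ` fst c) \<and>
     homeomorphic_map (subtopology M (fst c))
       (subtopology euclidean (snd c ` fst c)) (snd c)"

definition chart_inv :: "('m, 'n::finite) chart \<Rightarrow> real^'n \<Rightarrow> 'm"
where
  "chart_inv c = inv_into (fst c) (snd c)"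

definition smooth_manifold :: "'m topology \<Rightarrow> ('m, 'n::finite) chart set \<Rightarrow> bool"
where
  "smooth_manifold M A \<longleftrightarrow>
     Hausdorff_space M \<and> second_countable M \<and>
     (\<forall>c\<in>A. is_chart M c) \<and>
     (\<Union>c\<in>A. fst c) = topspace M \<and>
     (\<forall>c\<in>A. \<forall>d\<in>A. smooth_on (snd c ` (fst c \<inter> fst d)) (snd d \<circ> chart_inv c))"

text \<open>
  A tangent vector at \<open>x\<close> is the family of its component vectors with respect to all charts
  of the atlas around \<open>x\<close>, subject to the contravariant transformation law; it is set
  to zero on all other arguments, so that equality of tangent vectors is equality of functions.
\<close>

type_synonym ('m, 'n) tvec = "('m, 'n) chart \<Rightarrow> real^'n"

definition tangent_space ::
  "('m, 'n::finite) chart set \<Rightarrow> 'm \<Rightarrow> ('m, 'n) tvec set"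
where
  "tangent_space A x = {v.
     (\<forall>c\<in>A. \<forall>d\<in>A. x \<in> fst c \<longrightarrow> x \<in> fst d \<longrightarrow>
        v d = frechet_derivative (snd d \<circ> chart_inv c) (at (snd c x)) (v c)) \<and>
     (\<forall>c. \<not> (c \<in> A \<and> x \<in> fst c) \<longrightarrow> v c = 0)}"

definition tvec_zero :: "('m, 'n::finite) tvec"
where
  "tvec_zero = (\<lambda>c. 0)"

definition tvec_scale :: "real \<Rightarrow> ('m, 'n::finite) tvec \<Rightarrow> ('m, 'n) tvec"
where
  "tvec_scale k v = (\<lambda>c. k *\<^sub>R v c)"

definition nonzero_tangent ::
  "('m, 'n::finite) chart set \<Rightarrow> 'm \<Rightarrow> ('m, 'n) tvec set"
where
  "nonzero_tangent A x = tangent_space A x - {tvec_zero}"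

text \<open>The tangent vector \<open>y\<^sup>i \<partial>/\<partial>x\<^sup>i\<close> at \<open>x\<close> whose components in the chart \<open>c\<close> are \<open>y\<close>.\<close>

definition tvec_of ::
  "('m, 'n::finite) chart set \<Rightarrow> ('m, 'n) chart \<Rightarrow> 'm \<Rightarrow> real^'n \<Rightarrow> ('m, 'n) tvec"
where
  "tvec_of A c x y = (\<lambda>d. if d \<in> A \<and> x \<in> fst d
     then frechet_derivative (snd d \<circ> chart_inv c) (at (snd c x)) y else 0)"

section \<open>Finsler and Riemannian metrics\<close>

definition partial_deriv :: "'n::finite \<Rightarrow> (real^'n \<Rightarrow> real) \<Rightarrow> real^'n \<Rightarrow> real"
where
  "partial_deriv i f y = frechet_derivative f (at y) (axis i 1)"

definition finsler_tensor ::
  "('m, 'n::finite) chart set \<Rightarrow> ('m \<Rightarrow> ('m, 'n) tvec \<Rightarrow> real) \<Rightarrow>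
   ('m, 'n) chart \<Rightarrow> 'm \<Rightarrow> real^'n \<Rightarrow> real^'n^'n"
where
  "finsler_tensor A F c x y = (\<chi> i j.
     1/2 * partial_deriv i (partial_deriv j (\<lambda>z. (F x (tvec_of A c x z))\<^sup>2)) y)"

text \<open>The value of \<open>F\<close> at the zero vector is irrelevant and left unconstrained.\<close>

definition finsler_metric ::
  "'m topology \<Rightarrow> ('m, 'n::finite) chart set \<Rightarrow> ('m \<Rightarrow> ('m, 'n) tvec \<Rightarrow> real) \<Rightarrow> bool"
where
  "finsler_metric M A F \<longleftrightarrow>
     (\<forall>c\<in>A. smooth_on ((snd c ` fst c) \<times> (- {0}))
        (\<lambda>(u, y). F (chart_inv c u) (tvec_of A c (chart_inv c u) y))) \<and>
     (\<forall>x\<in>topspace M. \<forall>v\<in>nonzero_tangent A x.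
        F x v > 0 \<and> (\<forall>k>0. F x (tvec_scale k v) = k * F x v)) \<and>
     (\<forall>c\<in>A. \<forall>x\<in>fst c. \<forall>y w. y \<noteq> 0 \<longrightarrow> w \<noteq> 0 \<longrightarrow>
        (\<Sum>i\<in>UNIV. \<Sum>j\<in>UNIV. finsler_tensor A F c x y $ i $ j * w $ i * w $ j) > 0)"

definition metric_comp ::
  "('m, 'n::finite) chart set \<Rightarrow> ('m \<Rightarrow> ('m, 'n) tvec \<Rightarrow> ('m, 'n) tvec \<Rightarrow> real) \<Rightarrow>
   ('m, 'n) chart \<Rightarrow> 'm \<Rightarrow> real^'n^'n"
where
  "metric_comp A a c x = (\<chi> i j. a x (tvec_of A c x (axis i 1)) (tvec_of A c x (axis j 1)))"

text \<open>The second clause expresses bilinearity of \<open>a x\<close> on the tangent space.\<close>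

definition riemannian_metric ::
  "'m topology \<Rightarrow> ('m, 'n::finite) chart set \<Rightarrow>
   ('m \<Rightarrow> ('m, 'n) tvec \<Rightarrow> ('m, 'n) tvec \<Rightarrow> real) \<Rightarrow> bool"
where
  "riemannian_metric M A a \<longleftrightarrow>
     (\<forall>c\<in>A. smooth_on (snd c ` fst c) (\<lambda>u. metric_comp A a c (chart_inv c u))) \<and>
     (\<forall>c\<in>A. \<forall>x\<in>fst c. \<forall>v\<in>tangent_space A x. \<forall>w\<in>tangent_space A x.
        a x v w = (\<Sum>i\<in>UNIV. \<Sum>j\<in>UNIV. metric_comp A a c x $ i $ j * v c $ i * w c $ j)) \<and>
     (\<forall>x\<in>topspace M. \<forall>v\<in>tangent_space A x. \<forall>w\<in>tangent_space A x. a x v w = a x w v) \<and>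
     (\<forall>x\<in>topspace M. \<forall>v\<in>nonzero_tangent A x. a x v v > 0)"

definition riemannian_norm ::
  "('m \<Rightarrow> ('m, 'n::finite) tvec \<Rightarrow> ('m, 'n) tvec \<Rightarrow> real) \<Rightarrow> 'm \<Rightarrow> ('m, 'n) tvec \<Rightarrow> real"
where
  "riemannian_norm a x v = sqrt (a x v v)"

section \<open>Conformal automorphism\<close>

definition conformally_automorphic ::
  "'m topology \<Rightarrow> ('m, 'n::finite) chart set \<Rightarrow> ('m \<Rightarrow> ('m, 'n) tvec \<Rightarrow> real) \<Rightarrow>
   ('m \<Rightarrow> ('m, 'n) tvec \<Rightarrow> ('m, 'n) tvec \<Rightarrow> real) \<Rightarrow> ('m \<Rightarrow> real) \<Rightarrow>
   ('m \<Rightarrow> ('m, 'n) tvec \<Rightarrow> ('m, 'n) tvec) \<Rightarrow> bool"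
where
  "conformally_automorphic M A F a H t \<longleftrightarrow>
     (\<forall>x\<in>topspace M. H x > 0) \<and>
     (\<forall>x\<in>topspace M. bij_betw (t x) (nonzero_tangent A x) (nonzero_tangent A x)) \<and>
     (\<forall>c\<in>A. smooth_on ((snd c ` fst c) \<times> (- {0}))
        (\<lambda>(u, y). t (chart_inv c u) (tvec_of A c (chart_inv c u) y) c)) \<and>
     (\<forall>x\<in>topspace M. \<forall>v\<in>nonzero_tangent A x. \<forall>k>0.
        t x (tvec_scale k v) = tvec_scale (k powr H x) (t x v)) \<and>
     (\<forall>x\<in>topspace M. \<forall>v\<in>nonzero_tangent A x.
        F x v = 1 \<longleftrightarrow> riemannian_norm a x (t x v) = 1) \<and>
     (\<exists>p :: 'm \<Rightarrow> ('m, 'n) tvec \<Rightarrow> real.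
        (\<forall>x\<in>topspace M. \<forall>v\<in>nonzero_tangent A x. p x v > 0) \<and>
        (\<forall>c\<in>A. \<forall>x\<in>fst c. \<forall>y. y \<noteq> 0 \<longrightarrow>
           (let J = jacobian (\<lambda>z. t x (tvec_of A c x z) c) (at y) in
            \<forall>m n. finsler_tensor A F c x y $ m $ n =
              (p x (tvec_of A c x y))\<^sup>2 *
              (\<Sum>i\<in>UNIV. \<Sum>j\<in>UNIV. metric_comp A a c x $ i $ j * J $ i $ m * J $ j $ n))))"

section \<open>Geodesic arcs on submanifolds of coordinate space\<close>

text \<open>
  Here \<open>g\<close> is a Riemannian metric given by its coefficient matrix on (an open part of)
  \<open>real^'n\<close>, and \<open>I\<close> is a submanifold with the induced metric. Geodesic arcs, parametrised on
  the unit interval, are the critical points of the energy under variations through curves in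
  \<open>I\<close> with the same end points. (So they have constant speed, and an arc between equal points
  may be constant.)
\<close>

definition curve_length :: "(real^'n \<Rightarrow> real^'n^'n) \<Rightarrow> (real \<Rightarrow> real^'n::finite) \<Rightarrow> real"
where
  "curve_length g \<gamma> = integral {0..1} (\<lambda>s. let w = vector_derivative \<gamma> (at s) in
     sqrt (\<Sum>i\<in>UNIV. \<Sum>j\<in>UNIV. g (\<gamma> s) $ i $ j * w $ i * w $ j))"

definition curve_energy :: "(real^'n \<Rightarrow> real^'n^'n) \<Rightarrow> (real \<Rightarrow> real^'n::finite) \<Rightarrow> real"
where
  "curve_energy g \<gamma> = 1/2 * integral {0..1} (\<lambda>s. let w = vector_derivative \<gamma> (at s) in
     (\<Sum>i\<in>UNIV. \<Sum>j\<in>UNIV. g (\<gamma> s) $ i $ j * w $ i * w $ j))"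

definition smooth_arc :: "(real^'n) set \<Rightarrow> real^'n \<Rightarrow> real^'n \<Rightarrow> (real \<Rightarrow> real^'n::finite) \<Rightarrow> bool"
where
  "smooth_arc I p q \<gamma> \<longleftrightarrow>
     (\<exists>W. open W \<and> {0..1} \<subseteq> W \<and> smooth_on W \<gamma>) \<and>
     (\<forall>s\<in>{0..1}. \<gamma> s \<in> I) \<and> \<gamma> 0 = p \<and> \<gamma> 1 = q"

definition proper_variation ::
  "(real^'n) set \<Rightarrow> (real \<Rightarrow> real^'n) \<Rightarrow> (real \<Rightarrow> real \<Rightarrow> real^'n::finite) \<Rightarrow> bool"
where
  "proper_variation I \<gamma> \<Gamma> \<longleftrightarrow>
     (\<exists>\<delta>>0. (\<exists>W. open W \<and> {-\<delta><..<\<delta>} \<times> {0..1} \<subseteq> W \<and> smooth_on W (\<lambda>(e, s). \<Gamma> e s)) \<and>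
        (\<forall>e\<in>{-\<delta><..<\<delta>}. (\<forall>s\<in>{0..1}. \<Gamma> e s \<in> I) \<and> \<Gamma> e 0 = \<gamma> 0 \<and> \<Gamma> e 1 = \<gamma> 1)) \<and>
     (\<forall>s\<in>{0..1}. \<Gamma> 0 s = \<gamma> s)"

definition geodesic_arc ::
  "(real^'n \<Rightarrow> real^'n^'n) \<Rightarrow> (real^'n) set \<Rightarrow> real^'n \<Rightarrow> real^'n \<Rightarrow>
   (real \<Rightarrow> real^'n::finite) \<Rightarrow> bool"
where
  "geodesic_arc g I p q \<gamma> \<longleftrightarrow> smooth_arc I p q \<gamma> \<and>
     (\<forall>\<Gamma>. proper_variation I \<gamma> \<Gamma> \<longrightarrow>
        ((\<lambda>e. curve_energy g (\<Gamma> e)) has_real_derivative 0) (at 0))"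

definition shortest_geodesic_arc ::
  "(real^'n \<Rightarrow> real^'n^'n) \<Rightarrow> (real^'n) set \<Rightarrow> real^'n \<Rightarrow> real^'n \<Rightarrow>
   (real \<Rightarrow> real^'n::finite) \<Rightarrow> bool"
where
  "shortest_geodesic_arc g I p q \<gamma> \<longleftrightarrow> geodesic_arc g I p q \<gamma> \<and>
     (\<forall>\<eta>. geodesic_arc g I p q \<eta> \<longrightarrow> curve_length g \<gamma> \<le> curve_length g \<eta>)"

section \<open>The Finslerian angle\<close>

definition indicatrix ::
  "('m, 'n::finite) chart set \<Rightarrow> ('m \<Rightarrow> ('m, 'n) tvec \<Rightarrow> real) \<Rightarrow>
   ('m, 'n) chart \<Rightarrow> 'm \<Rightarrow> (real^'n) set"
where
  "indicatrix A F c x = {y. y \<noteq> 0 \<and> F x (tvec_of A c x y) = 1}"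

text \<open>
  Two points of the indicatrix are in general joined by several geodesic arcs; the angle is the
  length of a shortest one. It is computed in the coordinates of a chart \<open>c\<close> around \<open>x\<close>.
\<close>

definition is_finsler_angle ::
  "('m, 'n::finite) chart set \<Rightarrow> ('m \<Rightarrow> ('m, 'n) tvec \<Rightarrow> real) \<Rightarrow> ('m, 'n) chart \<Rightarrow> 'm \<Rightarrow>
   ('m, 'n) tvec \<Rightarrow> ('m, 'n) tvec \<Rightarrow> real \<Rightarrow> bool"
where
  "is_finsler_angle A F c x y1 y2 \<alpha> \<longleftrightarrow>
     (\<exists>\<gamma>. shortest_geodesic_arc (finsler_tensor A F c x) (indicatrix A F c x)
             ((1 / F x y1) *\<^sub>R y1 c) ((1 / F x y2) *\<^sub>R y2 c) \<gamma> \<and>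
           \<alpha> = curve_length (finsler_tensor A F c x) \<gamma>)"

definition finsler_angle ::
  "('m, 'n::finite) chart set \<Rightarrow> ('m \<Rightarrow> ('m, 'n) tvec \<Rightarrow> real) \<Rightarrow> ('m, 'n) chart \<Rightarrow> 'm \<Rightarrow>
   ('m, 'n) tvec \<Rightarrow> ('m, 'n) tvec \<Rightarrow> real"
where
  "finsler_angle A F c x y1 y2 = (THE \<alpha>. is_finsler_angle A F c x y1 y2 \<alpha>)"

end

theory Submission
  imports Defs
begin

text \<open>
  Euler's theorem on homogeneous functions forces \<open>p = 1/H\<close> on the indicatrix, so \<open>t\<close> maps the
  indicatrix with the metric \<open>g\<close> onto the unit sphere of \<open>a\<close> and multiplies lengths by \<open>H\<close>.
  Every arc on that sphere is at least as long as the angle between its end points, and by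
  Cauchy-Schwarz a great circle arc of exactly this length also minimises the energy. It is
  therefore a critical point of the energy, hence a geodesic arc, without any computation of the
  first variation.
\<close>

section \<open>Closure properties of \<open>k\<close> times continuously differentiable maps\<close>

text \<open>At a minimum the derivative vanishes only if it exists, so differentiability of the
  energy along a variation has to be shown separately, by differentiating under the integral sign. A
  second obstacle is that geodesic arcs live on the indicatrix while great circles live on its
  image: the great circle must be pulled back through the inverse of \<open>t\<close>, but only
  \<open>t\<close> itself is assumed smooth. The differential of \<open>t\<close> is injective
  because (iii) would otherwise contradict the positive definiteness of \<open>g\<close>; smoothness
  of the lifted curve then follows order by order. Off the indicatrix the conformal factor may vary,
  since Euler's theorem gives \<open>p^2 H^2 a(t,t) = F^2\<close>; only the restriction to
  \<open>F = 1\<close> makes it constant and turns a conformal map into a homothety.\<close>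

lemma has_derivative_frechet:
  "f differentiable (at x) \<Longrightarrow> (f has_derivative frechet_derivative f (at x)) (at x)"
  using frechet_derivative_works by blast

lemma C_k_on_subset: "C_k_on k f S \<Longrightarrow> T \<subseteq> S \<Longrightarrow> C_k_on k f T"
  by (induction k arbitrary: f) (auto intro: continuous_on_subset)

lemma C_k_on_SucD: "C_k_on (Suc k) f S \<Longrightarrow> C_k_on k f S"
proof (induction k arbitrary: f)
  case 0
  then show ?case
    by (auto intro!: continuous_at_imp_continuous_on differentiable_imp_continuous_within)
next
  case (Suc k)
  then show ?case by (subst C_k_on.simps) (auto simp del: C_k_on.simps(2) simp: C_k_on.simps(2)[of "Suc k"])
qed

text \<open>On an open set the values of a function determine its derivative, so the choice operator
  \<open>frechet_derivative\<close> picks the same map for \<open>f\<close> and \<open>g\<close>,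
  and the induction can pass to the derivatives.\<close>

lemma C_k_on_cong:
  assumes "open S" "C_k_on k f S" "\<And>x. x \<in> S \<Longrightarrow> f x = g x"
  shows "C_k_on k g S"
  using assms(2,3)
proof (induction k arbitrary: f g)
  case 0
  then show ?case by (simp cong: continuous_on_cong)
next
  case (Suc k)
  have d: "(g has_derivative frechet_derivative f (at x)) (at x)" if "x \<in> S" for x
    using has_derivative_transform_within_open[OF has_derivative_frechet assms(1) that] Suc.prems that
    by auto
  have eq: "frechet_derivative f (at x) = frechet_derivative g (at x)" if "x \<in> S" for x
    using frechet_derivative_at[OF d[OF that]] .
  have "C_k_on k (\<lambda>x. frechet_derivative g (at x) v) S" for v
    by (rule Suc.IH[of "\<lambda>x. frechet_derivative f (at x) v"]) (use Suc.prems eq in auto)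
  with d show ?case
    by (auto simp: differentiable_def)
qed

text \<open>\<open>C_k_on\<close> speaks of \<open>frechet_derivative\<close>; this rule lets the
  derivative be supplied by a formula instead, which is how most closure properties below are
  obtained.\<close>

lemma C_k_on_SucI:
  assumes "open S" "\<And>x. x \<in> S \<Longrightarrow> (f has_derivative f' x) (at x)"
    and "\<And>v. C_k_on k (\<lambda>x. f' x v) S"
  shows "C_k_on (Suc k) f S"
proof -
  have "frechet_derivative f (at x) = f' x" if "x \<in> S" for x
    using frechet_derivative_at[OF assms(2)[OF that]] by simp
  then have "C_k_on k (\<lambda>x. frechet_derivative f (at x) v) S" for v
    by (intro C_k_on_cong[OF assms(1) assms(3)[of v]]) simp
  with assms(2) show ?thesis
    by (auto simp: differentiable_def)
qed

lemma C_k_on_const: "C_k_on k (\<lambda>x. z) S"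
  by (induction k arbitrary: z) auto

lemma C_k_on_bounded_linear:
  assumes "open S" "bounded_linear L" "C_k_on k f S"
  shows "C_k_on k (\<lambda>x. L (f x)) S"
  using assms(3)
proof (induction k arbitrary: f)
  case 0
  then show ?case
    by (auto intro: bounded_linear.continuous_on[OF assms(2)])
next
  case (Suc k)
  show ?case
    by (rule C_k_on_SucI[OF assms(1), where f' = "\<lambda>x v. L (frechet_derivative f (at x) v)"])
      (use Suc in \<open>auto intro!: bounded_linear.has_derivative[OF assms(2)] has_derivative_frechet\<close>)
qed

lemma C_k_on_add:
  assumes "open S" "C_k_on k f S" "C_k_on k g S"
  shows "C_k_on k (\<lambda>x. f x + g x) S"
  using assms(2,3)
proof (induction k arbitrary: f g)
  case 0
  then show ?case by (auto intro: continuous_intros)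
next
  case (Suc k)
  show ?case
    by (rule C_k_on_SucI[OF assms(1), where f' = "\<lambda>x v. frechet_derivative f (at x) v + frechet_derivative g (at x) v"])
      (use Suc in \<open>auto intro!: has_derivative_add has_derivative_frechet\<close>)
qed

lemma C_k_on_sum:
  assumes "open S" "finite I" "\<And>i. i \<in> I \<Longrightarrow> C_k_on k (f i) S"
  shows "C_k_on k (\<lambda>x. \<Sum>i\<in>I. f i x) S"
  using assms(2,3)
  by (induction I rule: finite_induct) (auto intro: C_k_on_const C_k_on_add[OF assms(1)])

text \<open>The product rule leaves one factor undifferentiated, so the induction step also needs
  both functions at the lower order, through \<open>C_k_on_SucD\<close>.\<close>

lemma C_k_on_bilinear:
  assumes "open S" "bounded_bilinear B" "C_k_on k f S" "C_k_on k g S"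
  shows "C_k_on k (\<lambda>x. B (f x) (g x)) S"
  using assms(3,4)
proof (induction k arbitrary: f g)
  case 0
  then show ?case by (auto intro: bounded_bilinear.continuous_on[OF assms(2)])
next
  case (Suc k)
  show ?case
    by (rule C_k_on_SucI[OF assms(1), where f' = "\<lambda>x v. B (f x) (frechet_derivative g (at x) v) +
           B (frechet_derivative f (at x) v) (g x)"])
      (use Suc.IH Suc.prems C_k_on_SucD[OF Suc.prems(1)] C_k_on_SucD[OF Suc.prems(2)] in
        \<open>auto intro!: bounded_bilinear.FDERIV[OF assms(2)] has_derivative_frechet C_k_on_add[OF assms(1)]\<close>)
qed

lemmas C_k_on_mult = C_k_on_bilinear[OF _ bounded_bilinear_mult]
lemmas C_k_on_scaleR = C_k_on_bilinear[OF _ bounded_bilinear_scaleR]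

lemma C_k_on_prod:
  fixes f :: "'i \<Rightarrow> 'a::real_normed_vector \<Rightarrow> real"
  assumes "open S" "finite I" "\<And>i. i \<in> I \<Longrightarrow> C_k_on k (f i) S"
  shows "C_k_on k (\<lambda>x. \<Prod>i\<in>I. f i x) S"
  using assms(2,3)
  by (induction I rule: finite_induct) (auto intro: C_k_on_const C_k_on_mult[OF assms(1)])

text \<open>The derivative of \<open>1/f\<close> contains \<open>1/f\<close> again; the induction
  therefore keeps \<open>f\<close> fixed, and its hypothesis supplies these factors.\<close>

lemma C_k_on_inverse:
  fixes f :: "'a::real_normed_vector \<Rightarrow> real"
  assumes "open S" "C_k_on k f S" "\<And>x. x \<in> S \<Longrightarrow> f x \<noteq> 0"
  shows "C_k_on k (\<lambda>x. inverse (f x)) S"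
  using assms(2)
proof (induction k)
  case 0
  then show ?case using assms(3) by (auto intro: continuous_intros)
next
  case (Suc k)
  have "C_k_on k (\<lambda>x. inverse (f x)) S" using Suc.IH C_k_on_SucD[OF Suc.prems] .
  then have "C_k_on k (\<lambda>x. - (inverse (f x) * frechet_derivative f (at x) v * inverse (f x))) S" for v
    using Suc.prems by (intro C_k_on_bounded_linear[OF assms(1) bounded_linear_minus[OF bounded_linear_ident]]
      C_k_on_mult[OF assms(1)]) auto
  moreover have "((\<lambda>x. inverse (f x)) has_derivative
      (\<lambda>v. - (inverse (f x) * frechet_derivative f (at x) v * inverse (f x)))) (at x)" if "x \<in> S" for x
    by (rule Deriv.has_derivative_inverse) (use that Suc.prems assms(3) in \<open>auto intro: has_derivative_frechet\<close>)
  ultimately show ?case by (intro C_k_on_SucI[OF assms(1)])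
qed

text \<open>The chain rule evaluates the derivative of \<open>f\<close> in the direction
  \<open>Dg(x) v\<close>, which varies with \<open>x\<close>, while \<open>C_k_on\<close> controls
  fixed directions only. Expanding the direction in \<open>Basis\<close> resolves this and is the
  reason for the Euclidean type of the intermediate space.\<close>

lemma C_k_on_compose:
  fixes g :: "'a::real_normed_vector \<Rightarrow> 'b::euclidean_space"
  assumes "open S" "C_k_on k f T" "C_k_on k g S" "g ` S \<subseteq> T"
  shows "C_k_on k (\<lambda>x. f (g x)) S"
  using assms(2,3)
proof (induction k arbitrary: f)
  case 0
  then show ?case using assms(4) by (auto intro: continuous_on_compose2)
next
  case (Suc k)
  let ?f' = "\<lambda>x v. \<Sum>b\<in>Basis. (frechet_derivative g (at x) v \<bullet> b) *\<^sub>R frechet_derivative f (at (g x)) b"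
  have 1: "frechet_derivative f (at (g x)) (frechet_derivative g (at x) v) = ?f' x v"
    if "x \<in> S" for x v
  proof -
    have "linear (frechet_derivative f (at (g x)))"
      using Suc.prems(1) that assms(4) by (auto intro!: linear_frechet_derivative)
    then have "frechet_derivative f (at (g x)) (\<Sum>b\<in>Basis. (frechet_derivative g (at x) v \<bullet> b) *\<^sub>R b) = ?f' x v"
      by (simp add: linear_sum linear_scale)
    then show ?thesis by (simp add: euclidean_representation)
  qed
  have d: "((\<lambda>x. f (g x)) has_derivative ?f' x) (at x)" if "x \<in> S" for x
  proof -
    have "((\<lambda>x. f (g x)) has_derivative (\<lambda>v. frechet_derivative f (at (g x)) (frechet_derivative g (at x) v))) (at x)"
      by (rule has_derivative_compose[of g _ x UNIV f])
        (use that Suc.prems assms(4) in \<open>auto intro!: has_derivative_frechet\<close>)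
    then show ?thesis using 1[OF that] by simp
  qed
  show ?case
    by (rule C_k_on_SucI[OF assms(1) d])
      (use Suc.prems C_k_on_SucD[OF Suc.prems(2)] in
       \<open>auto intro!: C_k_on_sum[OF assms(1)] C_k_on_scaleR[OF assms(1)] Suc.IH
          C_k_on_bounded_linear[OF assms(1) bounded_linear_inner_left]\<close>)
qed

lemma C_k_on_vec:
  fixes f :: "'i::finite \<Rightarrow> 'a::real_normed_vector \<Rightarrow> real"
  assumes "open S" "\<And>i. C_k_on k (f i) S"
  shows "C_k_on k (\<lambda>x. \<chi> i. f i x) S"
proof -
  have "(\<chi> i. f i x) = (\<Sum>i\<in>UNIV. f i x *\<^sub>R axis i 1)" for x
    by (simp add: vec_eq_iff axis_def if_distrib cong: if_cong)
  then show ?thesis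
    using assms by (auto intro!: C_k_on_sum C_k_on_scaleR C_k_on_const)
qed

lemma C_k_on_det:
  fixes f :: "'a::real_normed_vector \<Rightarrow> real^'n^'n"
  assumes "open S" "\<And>i j. C_k_on k (\<lambda>x. f x $ i $ j) S"
  shows "C_k_on k (\<lambda>x. det (f x)) S"
  unfolding det_def
  using assms by (auto intro!: C_k_on_sum C_k_on_mult C_k_on_prod C_k_on_const finite_permutations)

text \<open>Serves to freeze the base point of a function of point and tangent vector, and the
  parameter of a variation. Differentiating the slice along \<open>v\<close> is differentiating
  \<open>f\<close> along \<open>(0, v)\<close>.\<close>

lemma C_k_on_slice:
  assumes "C_k_on k f W" "open V" "\<And>y. y \<in> V \<Longrightarrow> (u, y) \<in> W"
  shows "C_k_on k (\<lambda>y. f (u, y)) V"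
  using assms(1)
proof (induction k arbitrary: f)
  case 0
  then show ?case using assms(3) by (auto intro!: continuous_on_compose2[where f = "Pair u"] continuous_intros)
next
  case (Suc k)
  have "((\<lambda>y. f (u, y)) has_derivative (\<lambda>v. frechet_derivative f (at (u, y)) (0, v))) (at y)"
    if "y \<in> V" for y
    by (rule has_derivative_compose[of "Pair u" _ y UNIV f])
      (use that Suc.prems assms(3) in \<open>auto intro!: has_derivative_frechet derivative_eq_intros\<close>)
  then show ?case
    by (rule C_k_on_SucI[OF assms(2)])
      (use Suc.prems Suc.IH[of "\<lambda>x. frechet_derivative f (at x) (0, v)" for v] in auto)
qed

text \<open>Differentiation maps this family of curves to itself, replacing the pair
  \<open>(u, e)\<close> by \<open>(\<theta> v e, -\<theta> v u)\<close>; hence the induction over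
  arbitrary \<open>u\<close> and \<open>e\<close>.\<close>

lemma C_k_on_great_circle:
  fixes u e :: "'a::real_normed_vector"
  shows "C_k_on k (\<lambda>s. cos (\<theta> * s) *\<^sub>R u + sin (\<theta> * s) *\<^sub>R e) UNIV"
proof (induction k arbitrary: u e)
  case 0
  then show ?case by (auto intro!: continuous_intros)
next
  case (Suc k)
  have "C_k_on k (\<lambda>s. cos (\<theta> * s) *\<^sub>R ((\<theta> * v) *\<^sub>R e) + sin (\<theta> * s) *\<^sub>R (- ((\<theta> * v) *\<^sub>R u))) UNIV" for v
    by (rule Suc)
  then show ?case
    by (intro C_k_on_SucI[where f' = "\<lambda>s v. cos (\<theta> * s) *\<^sub>R ((\<theta> * v) *\<^sub>R e) + sin (\<theta> * s) *\<^sub>R (- ((\<theta> * v) *\<^sub>R u))"])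
      (auto intro!: derivative_eq_intros ext simp: algebra_simps)
qed

section \<open>Arcs on the unit sphere of an inner product\<close>

text \<open>Models \<open>a\<close> at the point \<open>x\<close> in the coordinates of a chart.
  Instead of passing to orthonormal coordinates, the geometry of the sphere is developed for an
  arbitrary positive form.\<close>

locale inner_form =
  fixes B :: "real^'n::finite \<Rightarrow> real^'n \<Rightarrow> real"
  assumes bilinear: "bounded_bilinear B"
    and sym: "B u v = B v u"
    and pos: "u \<noteq> 0 \<Longrightarrow> B u u > 0"
begin

sublocale bounded_bilinear B by (rule bilinear)

lemma nonneg: "B u u \<ge> 0"
  using pos[of u] by (cases "u = 0") (auto simp: zero_left)

lemma Cauchy_Schwarz: "(B u v)\<^sup>2 \<le> B u u * B v v"
proof (cases "v = 0")
  case False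
  \<comment> \<open>\<open>B v v\<close> times the component of \<open>u\<close> orthogonal to
    \<open>v\<close>; the scaling avoids a division.\<close>
  define w where "w = B v v *\<^sub>R u - B u v *\<^sub>R v"
  have "B w w = B v v * (B u u * B v v - (B u v)\<^sup>2)"
    unfolding w_def by (simp add: diff_left diff_right scaleR_left scaleR_right sym[of v u] algebra_simps power2_eq_square)
  with nonneg[of w] pos[OF False] show ?thesis
    by (simp add: zero_le_mult_iff)
qed (simp add: zero_right)

text \<open>As \<open>z\<close> is tangent to the sphere at \<open>w\<close>, only the component of
  \<open>u\<close> orthogonal to \<open>w\<close> contributes, and its square is
  \<open>1 - (B u w)\<^sup>2\<close>. Along a curve on the sphere this bounds the derivative of the
  cosine of the distance from \<open>u\<close>.\<close>

lemma sphere_tangent_bound: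
  assumes "B u u = 1" "B w w = 1" "B w z = 0"
  shows "(B u z)\<^sup>2 \<le> (1 - (B u w)\<^sup>2) * B z z"
proof -
  have "B (u - B u w *\<^sub>R w) z = B u z"
    using assms by (simp add: diff_left scaleR_left)
  moreover have "B (u - B u w *\<^sub>R w) (u - B u w *\<^sub>R w) = 1 - (B u w)\<^sup>2"
    using assms by (simp add: diff_left diff_right scaleR_left scaleR_right sym[of w u] algebra_simps power2_eq_square)
  ultimately show ?thesis
    using Cauchy_Schwarz[of "u - B u w *\<^sub>R w" z] by simp
qed

lemma abs_unit_le_1: "B u u = 1 \<Longrightarrow> B v v = 1 \<Longrightarrow> \<bar>B u v\<bar> \<le> 1"
  using Cauchy_Schwarz[of u v] by (simp add: abs_square_le_1)

text \<open>
  The distance \<open>arccos (B (\<sigma> 0) (\<sigma> s))\<close> is not differentiable where it is \<open>0\<close> or \<open>\<pi>\<close>; the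
  factor \<open>r < 1\<close> removes these singularities, and \<open>r \<rightarrow> 1\<close> at the end.
\<close>

lemma sphere_arc_length_ge:
  fixes \<sigma> \<sigma>' :: "real \<Rightarrow> real^'n"
  assumes der: "\<And>s. s \<in> {0..1} \<Longrightarrow> (\<sigma> has_vector_derivative \<sigma>' s) (at s)"
    and cont: "continuous_on {0..1} \<sigma>'"
    and unit: "\<And>s. s \<in> {0..1} \<Longrightarrow> B (\<sigma> s) (\<sigma> s) = 1"
  shows "arccos (B (\<sigma> 0) (\<sigma> 1)) \<le> integral {0..1} (\<lambda>s. sqrt (B (\<sigma>' s) (\<sigma>' s)))"
proof -
  let ?L = "integral {0..1} (\<lambda>s. sqrt (B (\<sigma>' s) (\<sigma>' s)))"
  define f where "f s = B (\<sigma> 0) (\<sigma> s)" for s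
  have ort: "B (\<sigma> s) (\<sigma>' s) = 0" if s: "s \<in> {0..1}" for s
  proof -
    have "((\<lambda>s. B (\<sigma> s) (\<sigma> s)) has_vector_derivative (B (\<sigma> s) (\<sigma>' s) + B (\<sigma>' s) (\<sigma> s))) (at s within {0..1})"
      using s by (intro has_vector_derivative has_vector_derivative_at_within[OF der])
    moreover have "((\<lambda>s. B (\<sigma> s) (\<sigma> s)) has_vector_derivative 0) (at s within {0..1})"
      by (rule has_vector_derivative_transform[OF s, of _ "\<lambda>_. 1"]) (use unit in auto)
    ultimately have "B (\<sigma> s) (\<sigma>' s) + B (\<sigma>' s) (\<sigma> s) = 0"
      using s vector_derivative_unique_within_closed_interval[of 0 1 s] by (simp add: cbox_interval)
    then show ?thesis by (simp add: sym[of "\<sigma>' s"])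
  qed
  have int: "(\<lambda>s. sqrt (B (\<sigma>' s) (\<sigma>' s))) integrable_on {0..1}"
    by (intro integrable_continuous_real continuous_intros continuous_on cont)
  have f1: "\<bar>f s\<bar> \<le> 1" if "s \<in> {0..1}" for s
    unfolding f_def using that by (intro abs_unit_le_1 unit) auto
  have f0: "f 0 = 1" by (simp add: f_def unit)
  have le: "arccos (r * f 1) - arccos r \<le> ?L" if r: "r \<in> {0<..<1}" for r
  proof -
    define d where "d s = inverse (- sqrt (1 - (r * f s)\<^sup>2)) * (r * B (\<sigma> 0) (\<sigma>' s))" for s
    have rf: "\<bar>r * f s\<bar> < 1" if "s \<in> {0..1}" for s
    proof -
      have "\<bar>r * f s\<bar> \<le> r * 1"
        unfolding abs_mult using f1[OF that] r by (intro mult_mono) auto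
      then show ?thesis using r by simp
    qed
    have fd: "(f has_real_derivative B (\<sigma> 0) (\<sigma>' s)) (at s within {0..1})" if "s \<in> {0..1}" for s
      unfolding f_def has_real_derivative_iff_has_vector_derivative
      using has_vector_derivative[OF has_vector_derivative_const[of "\<sigma> 0"]
          has_vector_derivative_at_within[OF der[OF that], of "{0..1}"]]
      by (simp add: zero_left)
    have "((\<lambda>s. arccos (r * f s)) has_vector_derivative d s) (at s within {0..1})" if "s \<in> {0..1}" for s
      unfolding has_real_derivative_iff_has_vector_derivative[symmetric] d_def
      by (rule DERIV_chain2[OF DERIV_arccos DERIV_cmult[OF fd[OF that]]]) (use rf[OF that] in auto)
    from fundamental_theorem_of_calculus[OF _ this]
    have "(d has_integral (arccos (r * f 1) - arccos r)) {0..1}" by (simp add: f0)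
    then show ?thesis
    proof (rule has_integral_le[OF _ integrable_integral[OF int]])
      fix s :: real assume s: "s \<in> {0..1}"
      have q: "1 - (r * f s)\<^sup>2 > 0" using rf[OF s] by (simp add: abs_square_less_1)
      \<comment> \<open>Tangency gives the factor \<open>r\<^sup>2 - (r * f s)\<^sup>2\<close>;
        enlarging \<open>r\<^sup>2\<close> to 1 produces the radicand in the derivative of
        \<open>arccos\<close>.\<close>
      have "(r * B (\<sigma> 0) (\<sigma>' s))\<^sup>2 \<le> (r\<^sup>2 - (r * f s)\<^sup>2) * B (\<sigma>' s) (\<sigma>' s)"
        using mult_left_mono[OF sphere_tangent_bound[OF unit[of 0] unit[OF s] ort[OF s]], of "r\<^sup>2"]
        by (simp add: f_def power_mult_distrib algebra_simps)
      also have "\<dots> \<le> (1 - (r * f s)\<^sup>2) * B (\<sigma>' s) (\<sigma>' s)"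
        using r by (intro mult_right_mono nonneg) (simp add: power_le_one)
      finally have "\<bar>r * B (\<sigma> 0) (\<sigma>' s)\<bar> \<le> sqrt (1 - (r * f s)\<^sup>2) * sqrt (B (\<sigma>' s) (\<sigma>' s))"
        unfolding real_sqrt_mult[symmetric] by (rule real_le_rsqrt[of "\<bar>_\<bar>", unfolded power2_abs])
      then show "d s \<le> sqrt (B (\<sigma>' s) (\<sigma>' s))"
        unfolding d_def using q by (auto simp: field_simps abs_le_iff)
    qed
  qed
  have rf1: "\<bar>r * f 1\<bar> \<le> 1" if "r \<in> {0..1}" for r
    unfolding abs_mult using f1[of 1] that by (intro mult_le_one) auto
  \<comment> \<open>The left-hand side is continuous in \<open>r\<close> up to \<open>r = 1\<close>,
    where the correction term \<open>arccos r\<close> becomes 0.\<close>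
  have "arccos (1 * f 1) - arccos 1 \<le> ?L"
  proof (rule continuous_le_on_closure[where S = "{0<..<1}" and f = "\<lambda>r. arccos (r * f 1) - arccos r"])
    show "continuous_on (closure {0<..<1}) (\<lambda>r. arccos (r * f 1) - arccos r)"
      using rf1 by (auto intro!: continuous_intros simp: abs_le_iff)
  qed (use le in auto)
  then show ?thesis by (simp add: f_def)
qed

section \<open>Great circles through two points\<close>

lemma exists_unit_orthogonal:
  assumes "CARD('n) \<ge> 2" "B u u = 1"
  obtains e where "B e e = 1" "B u e = 0"
proof -
  have "span {u} \<noteq> UNIV"
  proof
    assume "span {u} = UNIV"
    then have "dim (UNIV :: (real^'n) set) \<le> card {u}"
      by (intro dim_le_card) auto
    then show False using assms(1) by simp
  qed
  then obtain w where w: "w \<notin> span {u}" by auto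
  define z where "z = w - B u w *\<^sub>R u"
  have "w \<noteq> B u w *\<^sub>R u" using w by (metis span_base span_scale insertI1)
  then have z0: "B z z > 0" by (intro pos) (simp add: z_def)
  have "B u z = 0" by (simp add: z_def diff_right scaleR_right assms)
  then show ?thesis
    using z0 by (intro that[of "(1 / sqrt (B z z)) *\<^sub>R z"]) (auto simp: scaleR_left scaleR_right)
qed

text \<open>Writing \<open>v = l u + w\<close> with \<open>w\<close> orthogonal to \<open>u\<close>
  gives \<open>B w w = 1 - l\<^sup>2\<close>, the square of \<open>sin (arccos l)\<close>; so
  \<open>e\<close> is the normalised \<open>w\<close>.\<close>

lemma great_circle_through:
  assumes "CARD('n) \<ge> 2" "B u u = 1" "B v v = 1"
  obtains e where "B e e = 1" "B u e = 0"
    "v = cos (arccos (B u v)) *\<^sub>R u + sin (arccos (B u v)) *\<^sub>R e"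
proof -
  define l where "l = B u v"
  define w where "w = v - l *\<^sub>R u"
  have l: "\<bar>l\<bar> \<le> 1" unfolding l_def by (intro abs_unit_le_1 assms)
  have uw: "B u w = 0" by (simp add: w_def diff_right scaleR_right assms l_def)
  have ww: "B w w = 1 - l\<^sup>2"
    by (simp add: w_def diff_left diff_right scaleR_left scaleR_right assms l_def sym[of v u] power2_eq_square)
  have "\<exists>e. B e e = 1 \<and> B u e = 0 \<and> w = sqrt (1 - l\<^sup>2) *\<^sub>R e"
  proof (cases "w = 0")
    \<comment> \<open>Equal or antipodal points: any unit \<open>e\<close> orthogonal to
      \<open>u\<close> will do, and dimension at least 2 provides one.\<close>
    case True
    then have "l\<^sup>2 = 1" using ww by (simp add: zero_left)
    with True show ?thesis using exists_unit_orthogonal[OF assms(1,2)] by force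
  next
    case False
    with pos[of w] ww have "1 - l\<^sup>2 > 0" by simp
    then show ?thesis using uw ww
      by (intro exI[of _ "(1 / sqrt (1 - l\<^sup>2)) *\<^sub>R w"]) (simp add: scaleR_left scaleR_right)
  qed
  then obtain e where e: "B e e = 1" "B u e = 0" "w = sqrt (1 - l\<^sup>2) *\<^sub>R e" by blast
  have "v = cos (arccos l) *\<^sub>R u + sin (arccos l) *\<^sub>R e"
    using e(3) l by (simp add: w_def sin_arccos_abs abs_le_iff algebra_simps)
  from e(1,2) this[unfolded l_def] show ?thesis by (rule that)
qed

end

section \<open>A hypersurface homothetic to the unit sphere\<close>

text \<open>\<open>g\<close> is tied to \<open>T\<close> at the points of \<open>I\<close> only,
  because the factor \<open>1/H\<close> arises only where \<open>F = 1\<close>. The immersion clause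
  makes the bijection \<open>T\<close> a local diffeomorphism.\<close>

locale homothetic_sphere = inner_form B
  for B :: "real^'n::finite \<Rightarrow> real^'n \<Rightarrow> real" +
  fixes T :: "real^'n \<Rightarrow> real^'n"
    and H :: real
    and g :: "real^'n \<Rightarrow> real^'n^'n"
    and I :: "(real^'n) set"
  assumes T_smooth: "smooth_on (-{0}) T"
    and T_bij: "bij_betw T (-{0}) (-{0})"
    and T_immersion: "y \<noteq> 0 \<Longrightarrow> w \<noteq> 0 \<Longrightarrow> frechet_derivative T (at y) w \<noteq> 0"
    and H_pos: "H > 0"
    and I_iff: "y \<in> I \<longleftrightarrow> y \<noteq> 0 \<and> B (T y) (T y) = 1"
    and g_pullback: "y \<in> I \<Longrightarrow> (\<Sum>i\<in>UNIV. \<Sum>j\<in>UNIV. g y $ i $ j * w $ i * w $ j) =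
      B (frechet_derivative T (at y) w) (frechet_derivative T (at y) w) / H\<^sup>2"
begin

section \<open>Length and energy of arcs measured on the unit sphere\<close>

lemma T_C_k: "C_k_on k T (-{0})"
  using T_smooth by (simp add: smooth_on_def)

lemma T_has_derivative: "y \<noteq> 0 \<Longrightarrow> (T has_derivative frechet_derivative T (at y)) (at y)"
  using T_C_k[of "Suc 0"] by (auto intro: has_derivative_frechet)

lemma C_k_on_T_compose:
  fixes f :: "'a::real_normed_vector \<Rightarrow> real^'n"
  assumes "open W" "C_k_on k f W" "\<And>z. z \<in> W \<Longrightarrow> f z \<noteq> 0"
  shows "C_k_on k (\<lambda>z. T (f z)) W"
  by (rule C_k_on_compose[OF assms(1) T_C_k assms(2)]) (use assms(3) in auto)

text \<open>By the chain rule the velocity of the image curve is the differential of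
  \<open>T\<close> applied to the velocity of \<open>\<eta>\<close>, so its \<open>B\<close>-norm is
  \<open>H\<close> times the \<open>g\<close>-norm of the latter.\<close>

lemma arc_image:
  assumes W: "open W" "{0..1} \<subseteq> W" and C: "C_k_on 1 \<eta> W"
    and I: "\<And>s. s \<in> {0..1} \<Longrightarrow> \<eta> s \<in> I"
  obtains \<sigma>' where
    "\<And>s. s \<in> {0..1} \<Longrightarrow> ((\<lambda>s. T (\<eta> s)) has_vector_derivative \<sigma>' s) (at s)"
    "continuous_on {0..1} \<sigma>'"
    "curve_length g \<eta> = integral {0..1} (\<lambda>s. sqrt (B (\<sigma>' s) (\<sigma>' s))) / H"
    "curve_energy g \<eta> = 1/2 * (integral {0..1} (\<lambda>s. B (\<sigma>' s) (\<sigma>' s)) / H\<^sup>2)"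
proof -
  have \<eta>: "\<eta> differentiable (at s)" if "s \<in> {0..1}" for s
    using C W that by auto
  have "continuous_on W \<eta>"
    using C_k_on_SucD[of 0 \<eta> W] C by simp
  \<comment> \<open>Outside [0,1] the curve may pass through 0, where \<open>T\<close> is not
    assumed smooth.\<close>
  define W' where "W' = W \<inter> \<eta> -` (-{0})"
  have W': "open W'"
    unfolding W'_def using \<open>continuous_on W \<eta>\<close> W(1) by (intro continuous_open_preimage) auto
  have "{0..1} \<subseteq> W'" using W I I_iff by (auto simp: W'_def)
  have C': "C_k_on 1 (\<lambda>s. T (\<eta> s)) W'"
    by (rule C_k_on_T_compose[OF W' C_k_on_subset[OF C]]) (auto simp: W'_def)
  define \<sigma>' where "\<sigma>' s = frechet_derivative (\<lambda>s. T (\<eta> s)) (at s) 1" for s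
  have cont: "continuous_on {0..1} \<sigma>'"
    unfolding \<sigma>'_def using C' \<open>{0..1} \<subseteq> W'\<close> by (auto intro: continuous_on_subset)
  have der: "((\<lambda>s. T (\<eta> s)) has_vector_derivative \<sigma>' s) (at s)" if "s \<in> {0..1}" for s
  proof -
    have d: "(\<lambda>s. T (\<eta> s)) differentiable (at s)" using C' \<open>{0..1} \<subseteq> W'\<close> that by auto
    have "frechet_derivative (\<lambda>s. T (\<eta> s)) (at s) h = h *\<^sub>R \<sigma>' s" for h
      using linear_scale[OF linear_frechet_derivative[OF d], of h 1] by (simp add: \<sigma>'_def)
    then have "frechet_derivative (\<lambda>s. T (\<eta> s)) (at s) = (\<lambda>h. h *\<^sub>R \<sigma>' s)" by (rule ext)
    then show ?thesis
      using has_derivative_frechet[OF d] by (simp only: has_vector_derivative_def)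
  qed
  have \<sigma>'_eq: "\<sigma>' s = frechet_derivative T (at (\<eta> s)) (vector_derivative \<eta> (at s))" if "s \<in> {0..1}" for s
  proof -
    have "(\<eta> has_derivative (\<lambda>h. h *\<^sub>R vector_derivative \<eta> (at s))) (at s)"
      using \<eta>[OF that] by (simp add: vector_derivative_works[unfolded has_vector_derivative_def])
    from has_derivative_compose[OF this T_has_derivative]
    have "((\<lambda>s. T (\<eta> s)) has_derivative (\<lambda>h. frechet_derivative T (at (\<eta> s)) (h *\<^sub>R vector_derivative \<eta> (at s)))) (at s)"
      using I[OF that] I_iff by blast
    from fun_cong[OF frechet_derivative_at[OF this], of 1] show ?thesis
      by (simp add: \<sigma>'_def)
  qed
  have q: "(\<Sum>i\<in>UNIV. \<Sum>j\<in>UNIV. g (\<eta> s) $ i $ j * vector_derivative \<eta> (at s) $ i * vector_derivative \<eta> (at s) $ j)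
      = B (\<sigma>' s) (\<sigma>' s) / H\<^sup>2" if "s \<in> {0..1}" for s
    using g_pullback[OF I[OF that]] \<sigma>'_eq[OF that] by simp
  have "curve_length g \<eta> = integral {0..1} (\<lambda>s. sqrt (B (\<sigma>' s) (\<sigma>' s)) / H)"
    unfolding curve_length_def Let_def using q H_pos
    by (intro Henstock_Kurzweil_Integration.integral_cong) (simp add: real_sqrt_divide)
  moreover have "curve_energy g \<eta> = 1/2 * integral {0..1} (\<lambda>s. B (\<sigma>' s) (\<sigma>' s) / H\<^sup>2)"
    unfolding curve_energy_def Let_def using q
    by (intro arg_cong[where f = "\<lambda>x. 1/2 * x"] Henstock_Kurzweil_Integration.integral_cong) simp
  ultimately show ?thesis using der cont by (intro that[of \<sigma>']) auto
qed

lemma arc_length_ge: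
  assumes W: "open W" "{0..1} \<subseteq> W" and C: "C_k_on 1 \<eta> W"
    and I: "\<And>s. s \<in> {0..1} \<Longrightarrow> \<eta> s \<in> I"
  shows "arccos (B (T (\<eta> 0)) (T (\<eta> 1))) / H \<le> curve_length g \<eta>"
proof -
  obtain \<sigma>' where \<sigma>': "\<And>s. s \<in> {0..1} \<Longrightarrow> ((\<lambda>s. T (\<eta> s)) has_vector_derivative \<sigma>' s) (at s)"
    "continuous_on {0..1} \<sigma>'" "curve_length g \<eta> = integral {0..1} (\<lambda>s. sqrt (B (\<sigma>' s) (\<sigma>' s))) / H"
    using arc_image[OF assms] by blast
  have "arccos (B (T (\<eta> 0)) (T (\<eta> 1))) \<le> integral {0..1} (\<lambda>s. sqrt (B (\<sigma>' s) (\<sigma>' s)))"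
    by (rule sphere_arc_length_ge[of "\<lambda>s. T (\<eta> s)", OF \<sigma>'(1,2)]) (use I I_iff in auto)
  then show ?thesis using H_pos by (simp add: \<sigma>'(3) divide_right_mono)
qed

text \<open>This is Cauchy-Schwarz against the constant function \<theta>: with \<open>l\<close> the
  speed of the image, integrate \<open>l\<^sup>2 \<ge> 2 \<theta> l - \<theta>\<^sup>2\<close> and
  use that the integral of \<open>l\<close> is at least \<theta> \<ge> 0.\<close>

lemma arc_energy_ge:
  assumes W: "open W" "{0..1} \<subseteq> W" and C: "C_k_on 1 \<eta> W"
    and I: "\<And>s. s \<in> {0..1} \<Longrightarrow> \<eta> s \<in> I"
  shows "1/2 * ((arccos (B (T (\<eta> 0)) (T (\<eta> 1))))\<^sup>2 / H\<^sup>2) \<le> curve_energy g \<eta>"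
proof -
  define \<theta> where "\<theta> = arccos (B (T (\<eta> 0)) (T (\<eta> 1)))"
  obtain \<sigma>' where \<sigma>': "\<And>s. s \<in> {0..1} \<Longrightarrow> ((\<lambda>s. T (\<eta> s)) has_vector_derivative \<sigma>' s) (at s)"
    "continuous_on {0..1} \<sigma>'"
    "curve_energy g \<eta> = 1/2 * (integral {0..1} (\<lambda>s. B (\<sigma>' s) (\<sigma>' s)) / H\<^sup>2)"
    using arc_image[OF assms] by blast
  let ?l = "\<lambda>s. sqrt (B (\<sigma>' s) (\<sigma>' s))"
  have len: "\<theta> \<le> integral {0..1} ?l"
    unfolding \<theta>_def
    by (rule sphere_arc_length_ge[of "\<lambda>s. T (\<eta> s)", OF \<sigma>'(1,2)]) (use I I_iff in auto)
  have \<theta>: "0 \<le> \<theta>"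
    unfolding \<theta>_def using I[of 0] I[of 1] I_iff abs_unit_le_1[of "T (\<eta> 0)" "T (\<eta> 1)"]
    by (intro arccos_lbound) (auto simp: abs_le_iff)
  have int: "(\<lambda>s. B (\<sigma>' s) (\<sigma>' s)) integrable_on {0..1}" "?l integrable_on {0..1}"
    by (intro integrable_continuous_real continuous_intros continuous_on \<sigma>'(2))+
  have "((\<lambda>s. 2 * \<theta> * ?l s - \<theta>\<^sup>2) has_integral (2 * \<theta> * integral {0..1} ?l - \<theta>\<^sup>2)) {0..1}"
    using has_integral_diff[OF has_integral_mult_right[OF integrable_integral[OF int(2)]] has_integral_const_real[of "\<theta>\<^sup>2" 0 1]]
    by simp
  then have "2 * \<theta> * integral {0..1} ?l - \<theta>\<^sup>2 \<le> integral {0..1} (\<lambda>s. B (\<sigma>' s) (\<sigma>' s))"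
  proof (rule has_integral_le[OF _ integrable_integral[OF int(1)]])
    fix s
    show "2 * \<theta> * ?l s - \<theta>\<^sup>2 \<le> B (\<sigma>' s) (\<sigma>' s)"
      using zero_le_power2[of "?l s - \<theta>"] nonneg[of "\<sigma>' s"] by (simp add: power2_diff algebra_simps)
  qed
  moreover have "2 * \<theta> * \<theta> \<le> 2 * \<theta> * integral {0..1} ?l"
    using len \<theta> by (intro mult_left_mono) auto
  ultimately have "\<theta>\<^sup>2 \<le> integral {0..1} (\<lambda>s. B (\<sigma>' s) (\<sigma>' s))"
    by (simp add: power2_eq_square)
  then show ?thesis
    unfolding \<sigma>'(3) \<theta>_def[symmetric] by (intro mult_left_mono divide_right_mono) auto
qed

text \<open>Second-order regularity enters as one derivative in \<open>s\<close> for the velocity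
  and another in \<open>e\<close> for the Leibniz rule.\<close>

lemma energy_differentiable:
  assumes \<delta>: "\<delta> > 0" and W: "open W" "{-\<delta><..<\<delta>} \<times> {0..1} \<subseteq> W"
    and C: "C_k_on 2 (\<lambda>(e, s). \<Gamma> e s) W"
    and I: "\<And>e s. e \<in> {-\<delta><..<\<delta>} \<Longrightarrow> s \<in> {0..1} \<Longrightarrow> \<Gamma> e s \<in> I"
  shows "\<exists>D. ((\<lambda>e. curve_energy g (\<Gamma> e)) has_real_derivative D) (at 0)"
proof -
  let ?U = "{-\<delta><..<\<delta>}"
  let ?\<Gamma> = "\<lambda>z. \<Gamma> (fst z) (snd z)"
  have C: "C_k_on (Suc 1) ?\<Gamma> W" using C by (simp add: split_beta' numeral_2_eq_2)
  then have "continuous_on W ?\<Gamma>"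
    using C_k_on_SucD[of 0 ?\<Gamma> W] C_k_on_SucD[of 1 ?\<Gamma> W] by simp
  define W' where "W' = W \<inter> ?\<Gamma> -` (-{0})"
  have W': "open W'"
    unfolding W'_def using \<open>continuous_on W ?\<Gamma>\<close> W(1) by (intro continuous_open_preimage) auto
  have sub: "?U \<times> {0..1} \<subseteq> W'" using W I I_iff by (auto simp: W'_def)
  define \<Phi> where "\<Phi> z = T (?\<Gamma> z)" for z
  have C': "C_k_on (Suc 1) \<Phi> W'"
    unfolding \<Phi>_def by (rule C_k_on_T_compose[OF W' C_k_on_subset[OF C]]) (auto simp: W'_def)
  \<comment> \<open>Twice the energy density, expressed through the image curves. In this form it is
    continuously differentiable in both variables on the open set \<open>W'\<close>.\<close>
  define h where "h z = B (frechet_derivative \<Phi> (at z) (0, 1)) (frechet_derivative \<Phi> (at z) (0, 1)) / H\<^sup>2" for z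
  have h: "C_k_on (Suc 0) h W'"
    unfolding h_def using C'
    by (intro C_k_on_bounded_linear[OF W' bounded_linear_divide] C_k_on_bilinear[OF W' bilinear]) auto
  have en: "curve_energy g (\<Gamma> e) = 1/2 * integral (cbox 0 1) (\<lambda>s. h (e, s))" if e: "e \<in> ?U" for e
  proof -
    have "(\<Sum>i\<in>UNIV. \<Sum>j\<in>UNIV. g (\<Gamma> e s) $ i $ j * vector_derivative (\<Gamma> e) (at s) $ i * vector_derivative (\<Gamma> e) (at s) $ j)
       = h (e, s)" if s: "s \<in> {0..1}" for s
    proof -
      have es: "(e, s) \<in> W'" using e s sub by blast
      have d: "(?\<Gamma> has_derivative frechet_derivative ?\<Gamma> (at (e, s))) (at (e, s))"
        using es C by (auto intro!: has_derivative_frechet simp: W'_def)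
      have p: "((\<lambda>s. (e, s)) has_derivative (\<lambda>t. (0, t))) (at s)"
        by (auto intro!: derivative_eq_intros)
      \<comment> \<open>The velocity of the single curve \<open>\<Gamma> e\<close> is the partial
        derivative of the variation in the direction \<open>(0, 1)\<close>.\<close>
      define w where "w = frechet_derivative ?\<Gamma> (at (e, s)) (0, 1)"
      have "(\<Gamma> e has_derivative (\<lambda>t. frechet_derivative ?\<Gamma> (at (e, s)) (0, t))) (at s)"
        using has_derivative_compose[OF p d] by simp
      moreover have "frechet_derivative ?\<Gamma> (at (e, s)) (0, t) = t *\<^sub>R w" for t
        using linear_scale[OF has_derivative_linear[OF d], of t "(0, 1)"] by (simp add: w_def)
      ultimately have "(\<Gamma> e has_vector_derivative w) (at s)"
        by (simp add: has_vector_derivative_def)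
      then have w: "vector_derivative (\<Gamma> e) (at s) = w" by (rule vector_derivative_at)
      have "(T has_derivative frechet_derivative T (at (?\<Gamma> (e, s)))) (at (?\<Gamma> (e, s)))"
        by (rule T_has_derivative) (use es in \<open>simp add: W'_def\<close>)
      from has_derivative_compose[OF d this]
      have "(\<Phi> has_derivative (\<lambda>v. frechet_derivative T (at (\<Gamma> e s)) (frechet_derivative ?\<Gamma> (at (e, s)) v))) (at (e, s))"
        unfolding \<Phi>_def by simp
      from fun_cong[OF frechet_derivative_at[OF this], of "(0, 1)"]
      have "frechet_derivative \<Phi> (at (e, s)) (0, 1) = frechet_derivative T (at (\<Gamma> e s)) w"
        by (simp add: w_def)
      then show ?thesis
        using g_pullback[OF I[OF e s]] by (simp add: w h_def)
    qed
    then show ?thesis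
      unfolding curve_energy_def Let_def cbox_interval
      by (intro arg_cong[where f = "\<lambda>x. 1/2 * x"] Henstock_Kurzweil_Integration.integral_cong) simp
  qed
  define h' where "h' z = frechet_derivative h (at z) (1, 0)" for z
  have "((\<lambda>e. integral (cbox 0 1) (\<lambda>s. h (e, s))) has_field_derivative integral (cbox 0 1) (\<lambda>s. h' (0, s))) (at 0 within ?U)"
  proof (rule leibniz_rule_field_derivative)
    fix e s :: real assume e: "e \<in> ?U" and s: "s \<in> cbox 0 1"
    then have "(e, s) \<in> W'" using sub by auto
    then have d: "(h has_derivative frechet_derivative h (at (e, s))) (at (e, s))"
      using h by (auto intro: has_derivative_frechet)
    have p: "((\<lambda>e. (e, s)) has_derivative (\<lambda>t. (t, 0))) (at e)"
      by (auto intro!: derivative_eq_intros)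
    have "((\<lambda>e. h (e, s)) has_derivative (\<lambda>t. frechet_derivative h (at (e, s)) (t, 0))) (at e)"
      using has_derivative_compose[OF p d] .
    moreover have "frechet_derivative h (at (e, s)) (t, 0) = h' (e, s) * t" for t
      using linear_scale[OF has_derivative_linear[OF d], of t "(1, 0)"] by (simp add: h'_def)
    ultimately show "((\<lambda>e. h (e, s)) has_field_derivative h' (e, s)) (at e within ?U)"
      by (auto simp: has_field_derivative_def intro: has_derivative_at_withinI)
  next
    fix e :: real assume e: "e \<in> ?U"
    have "continuous_on W' h" using C_k_on_SucD[OF h] by simp
    then show "(\<lambda>s. h (e, s)) integrable_on cbox 0 1"
      unfolding cbox_interval using sub e
      by (intro integrable_continuous_real continuous_on_compose2[of W' h "{0..1}" "Pair e"] continuous_intros) auto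
  next
    have "continuous_on W' h'" unfolding h'_def using h by auto
    then show "continuous_on (?U \<times> cbox 0 1) (\<lambda>(e, s). h' (e, s))"
      using continuous_on_subset[OF _ sub] by (simp add: split_beta' cbox_interval)
  next
    show "0 \<in> ?U" using \<delta> by simp
    show "convex ?U" by (rule convex_real_interval)
  qed
  moreover have "at 0 within ?U = at 0"
    using \<delta> by (intro at_within_open) auto
  ultimately have "((\<lambda>e. integral (cbox 0 1) (\<lambda>s. h (e, s))) has_real_derivative integral (cbox 0 1) (\<lambda>s. h' (0, s))) (at 0)"
    by metis
  from DERIV_cmult[OF this, of "1/2"]
  have "((\<lambda>e. 1/2 * integral (cbox 0 1) (\<lambda>s. h (e, s))) has_real_derivative 1/2 * integral (cbox 0 1) (\<lambda>s. h' (0, s))) (at 0)"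
    by simp
  then have "((\<lambda>e. curve_energy g (\<Gamma> e)) has_real_derivative 1/2 * integral (cbox 0 1) (\<lambda>s. h' (0, s))) (at 0)"
    by (rule has_field_derivative_transform_within_open[of _ _ _ ?U]) (use \<delta> en in auto)
  then show ?thesis ..
qed

section \<open>Inverting \<open>T\<close> and lifting curves through it\<close>

definition T_inv :: "real^'n \<Rightarrow> real^'n" where
  "T_inv = inv_into (-{0}) T"

lemma T_inv_T: "y \<noteq> 0 \<Longrightarrow> T_inv (T y) = y"
  using T_bij by (auto simp: T_inv_def bij_betw_def)

lemma T_inv_nonzero: "z \<noteq> 0 \<Longrightarrow> T_inv z \<noteq> 0"
  using inv_into_into[of z T "-{0}"] T_bij by (auto simp: T_inv_def bij_betw_def)

lemma T_T_inv: "z \<noteq> 0 \<Longrightarrow> T (T_inv z) = z"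
  using f_inv_into_f[of z T "-{0}"] T_bij by (auto simp: T_inv_def bij_betw_def)

text \<open>An injective linear endomorphism is surjective, so the differential of \<open>T\<close>
  has a right inverse \<open>G\<close>. The inverse function theorem, for a continuous map with a
  given left inverse, identifies \<open>G\<close> as the derivative of \<open>T_inv\<close>.\<close>

lemma T_inv_has_derivative:
  assumes "z \<noteq> 0"
  obtains G where "(T_inv has_derivative G) (at z)"
    "\<And>v. frechet_derivative T (at (T_inv z)) (G v) = v"
proof -
  let ?L = "frechet_derivative T (at (T_inv z))"
  have d: "(T has_derivative ?L) (at (T_inv z))"
    by (rule T_has_derivative) (use assms T_inv_nonzero in auto)
  have lin: "linear ?L" using has_derivative_linear[OF d] .
  moreover have "inj ?L"
    using T_immersion[OF T_inv_nonzero[OF assms]] by (auto simp: linear_injective_0[OF lin])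
  ultimately obtain G where G: "linear G" "?L \<circ> G = id"
    using linear_injective_imp_surjective linear_surjective_right_inverse by blast
  have "(T_inv has_derivative G) (at (T (T_inv z)))"
  proof (rule has_derivative_inverse_strong[OF _ _ _ _ d G(2)])
    show "continuous_on (-{0}) T" using T_C_k[of 0] by simp
  qed (use assms T_inv_nonzero T_inv_T in auto)
  with G(2) show ?thesis
    by (intro that[of G]) (auto simp: T_T_inv[OF assms] fun_eq_iff)
qed

text \<open>
  The lift \<open>\<gamma>\<close> of a curve \<open>\<sigma>\<close> through \<open>T\<close> satisfies \<open>\<gamma>' = (DT (\<gamma>))\<^sup>-\<^sup>1 \<sigma>'\<close>, whose right-hand side is by
  Cramer's rule a rational expression in quantities that are as smooth as \<open>\<gamma>\<close>.
\<close>

lemma C_k_on_lift: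
  fixes \<sigma> :: "real \<Rightarrow> real^'n"
  assumes \<sigma>: "\<And>k. C_k_on k \<sigma> UNIV" and nz: "\<And>s. \<sigma> s \<noteq> 0"
  shows "C_k_on k (\<lambda>s. T_inv (\<sigma> s)) UNIV"
proof -
  define A where "A s = matrix (frechet_derivative T (at (T_inv (\<sigma> s))))" for s
  define \<sigma>' where "\<sigma>' s = frechet_derivative \<sigma> (at s) 1" for s
  define w where "w s = (\<chi> k. det (\<chi> i j. if j = k then \<sigma>' s $ i else A s $ i $ j) / det (A s))" for s
  have lin: "linear (frechet_derivative T (at (T_inv (\<sigma> s))))" for s
    using has_derivative_linear[OF T_has_derivative[OF T_inv_nonzero[OF nz]]] .
  have det: "det (A s) \<noteq> 0" for s
    using T_immersion[OF T_inv_nonzero[OF nz]] det_nz_iff_inj[OF lin]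
    by (auto simp: linear_injective_0[OF lin] A_def)
  have d: "((\<lambda>s. T_inv (\<sigma> s)) has_derivative (\<lambda>h. h *\<^sub>R w s)) (at s)" for s
  proof -
    obtain G where G: "(T_inv has_derivative G) (at (\<sigma> s))"
      "\<And>v. frechet_derivative T (at (T_inv (\<sigma> s))) (G v) = v"
      using T_inv_has_derivative[OF nz] by blast
    have d\<sigma>: "(\<sigma> has_derivative frechet_derivative \<sigma> (at s)) (at s)"
      using \<sigma>[of "Suc 0"] by (auto intro: has_derivative_frechet)
    have "A s *v G (\<sigma>' s) = \<sigma>' s"
      using G(2) by (simp add: A_def matrix_works lin linear_matrix_vector_mul_eq)
    then have "G (\<sigma>' s) = w s"
      by (simp add: cramer[OF det] w_def)
    moreover have "frechet_derivative \<sigma> (at s) h = h *\<^sub>R \<sigma>' s" for h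
      using linear_scale[OF has_derivative_linear[OF d\<sigma>], of h 1] by (simp add: \<sigma>'_def)
    ultimately have "G (frechet_derivative \<sigma> (at s) h) = h *\<^sub>R w s" for h
      using linear_scale[OF has_derivative_linear[OF G(1)], of h "\<sigma>' s"] by simp
    then show ?thesis
      using has_derivative_compose[OF d\<sigma> G(1)] by simp
  qed
  show ?thesis
  proof (induction k)
    case 0
    show ?case
      using d by (auto intro!: continuous_at_imp_continuous_on has_derivative_continuous)
  next
    \<comment> \<open>If the lift is of class \<open>k\<close>, so are the entries of
      \<open>A\<close> and with them \<open>w\<close>, which is the derivative of the lift: one
      order is gained.\<close>
    case (Suc k)
    have C\<sigma>: "C_k_on k (\<lambda>s. \<sigma>' s $ i) UNIV" for i
      using \<sigma>[of "Suc k"] unfolding \<sigma>'_def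
      by (intro C_k_on_bounded_linear[OF open_UNIV bounded_linear_vec_nth]) auto
    have CA: "C_k_on k (\<lambda>s. A s $ i $ j) UNIV" for i j
    proof -
      have "C_k_on k (\<lambda>y. frechet_derivative T (at y) (axis j 1)) (-{0})"
        using T_C_k[of "Suc k"] by auto
      moreover have "(\<lambda>s. T_inv (\<sigma> s)) ` UNIV \<subseteq> -{0}"
        using T_inv_nonzero[OF nz] by auto
      ultimately have "C_k_on k (\<lambda>s. frechet_derivative T (at (T_inv (\<sigma> s))) (axis j 1)) UNIV"
        by (rule C_k_on_compose[OF open_UNIV _ Suc])
      from C_k_on_bounded_linear[OF open_UNIV bounded_linear_vec_nth this, of i] show ?thesis
        by (simp add: A_def matrix_def)
    qed
    have "C_k_on k (\<lambda>s. (\<chi> i j. if j = l then \<sigma>' s $ i else A s $ i $ j) $ i $ j) UNIV" for i j l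
      using C\<sigma> CA by (cases "j = l") auto
    then have "C_k_on k w UNIV"
      unfolding w_def divide_inverse using CA det
      by (intro C_k_on_vec C_k_on_mult C_k_on_inverse C_k_on_det) auto
    then show ?case
      by (intro C_k_on_SucI[OF open_UNIV d] C_k_on_scaleR C_k_on_const) auto
  qed
qed

theorem exists_shortest_geodesic_arc:
  assumes card: "CARD('n) \<ge> 2" and p: "p \<in> I" and q: "q \<in> I"
  obtains \<gamma> where "shortest_geodesic_arc g I p q \<gamma>"
    "curve_length g \<gamma> = arccos (B (T p) (T q)) / H"
proof -
  define \<theta> where "\<theta> = arccos (B (T p) (T q))"
  obtain e where e: "B e e = 1" "B (T p) e = 0" "T q = cos \<theta> *\<^sub>R T p + sin \<theta> *\<^sub>R e"
    using great_circle_through[OF card] p q I_iff unfolding \<theta>_def by metis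
  have pp: "B (T p) (T p) = 1" using p I_iff by simp
  have \<theta>: "0 \<le> \<theta>"
    unfolding \<theta>_def using p q I_iff abs_unit_le_1[of "T p" "T q"]
    by (intro arccos_lbound) (auto simp: abs_le_iff)
  \<comment> \<open>The great circle arc from \<open>T p\<close> to \<open>T q\<close>, run through
    on [0,1] with constant speed \<theta>, which makes Cauchy-Schwarz an equality. For \<theta> = 0
    it is a constant curve.\<close>
  define \<sigma> where "\<sigma> s = cos (\<theta> * s) *\<^sub>R T p + sin (\<theta> * s) *\<^sub>R e" for s
  define \<gamma> where "\<gamma> s = T_inv (\<sigma> s)" for s
  have unit: "B (\<sigma> s) (\<sigma> s) = 1" for s
    by (simp add: \<sigma>_def add_left add_right scaleR_left scaleR_right pp e(1,2) sym[of e "T p"] flip: power2_eq_square)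
  have nz: "\<sigma> s \<noteq> 0" for s using unit[of s] by (auto simp: zero_left)
  have C: "C_k_on k \<gamma> UNIV" for k
    unfolding \<gamma>_def by (rule C_k_on_lift[OF _ nz]) (simp add: \<sigma>_def C_k_on_great_circle)
  have T\<gamma>: "T (\<gamma> s) = \<sigma> s" for s by (simp add: \<gamma>_def T_T_inv nz)
  have \<gamma>I: "\<gamma> s \<in> I" for s
    by (simp add: I_iff T\<gamma> unit) (simp add: \<gamma>_def T_inv_nonzero nz)
  have ends: "\<gamma> 0 = p" "\<gamma> 1 = q"
    using p q I_iff e(3)[symmetric] by (simp_all add: \<gamma>_def \<sigma>_def T_inv_T)
  have arc: "smooth_arc I p q \<gamma>"
    unfolding smooth_arc_def smooth_on_def using C \<gamma>I ends by blast
  have ge: "\<theta> / H \<le> curve_length g \<eta>" if \<eta>: "smooth_arc I p q \<eta>" for \<eta>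
  proof -
    from \<eta> obtain W where "open W" "{0..1} \<subseteq> W" "C_k_on 1 \<eta> W"
      unfolding smooth_arc_def smooth_on_def by blast
    from arc_length_ge[OF this] \<eta> show ?thesis
      unfolding smooth_arc_def \<theta>_def by auto
  qed
  obtain \<sigma>' where \<sigma>': "\<And>s. s \<in> {0..1} \<Longrightarrow> ((\<lambda>s. T (\<gamma> s)) has_vector_derivative \<sigma>' s) (at s)"
    "curve_length g \<gamma> = integral {0..1} (\<lambda>s. sqrt (B (\<sigma>' s) (\<sigma>' s))) / H"
    "curve_energy g \<gamma> = 1/2 * (integral {0..1} (\<lambda>s. B (\<sigma>' s) (\<sigma>' s)) / H\<^sup>2)"
    using arc_image[OF open_UNIV subset_UNIV C \<gamma>I] by blast
  have speed: "B (\<sigma>' s) (\<sigma>' s) = \<theta>\<^sup>2" if "s \<in> {0..1}" for s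
  proof -
    have "(\<sigma> has_vector_derivative (- (\<theta> * sin (\<theta> * s))) *\<^sub>R T p + (\<theta> * cos (\<theta> * s)) *\<^sub>R e) (at s)"
      unfolding \<sigma>_def has_vector_derivative_def
      by (auto intro!: derivative_eq_intros ext simp: algebra_simps)
    with \<sigma>'(1)[OF that] have "\<sigma>' s = (- (\<theta> * sin (\<theta> * s))) *\<^sub>R T p + (\<theta> * cos (\<theta> * s)) *\<^sub>R e"
      unfolding T\<gamma> using vector_derivative_unique_at by blast
    moreover have "B (a *\<^sub>R T p + b *\<^sub>R e) (a *\<^sub>R T p + b *\<^sub>R e) = a\<^sup>2 + b\<^sup>2" for a b
      by (simp add: add_left add_right scaleR_left scaleR_right pp e(1,2) sym[of e "T p"] power2_eq_square)
    ultimately have "B (\<sigma>' s) (\<sigma>' s) = \<theta>\<^sup>2 * ((sin (\<theta> * s))\<^sup>2 + (cos (\<theta> * s))\<^sup>2)"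
      by (simp only: power2_minus power_mult_distrib distrib_left)
    then show ?thesis by simp
  qed
  have "integral {0..1} (\<lambda>s. sqrt (B (\<sigma>' s) (\<sigma>' s))) = integral {0..1} (\<lambda>s::real. \<theta>)"
    by (intro Henstock_Kurzweil_Integration.integral_cong) (use speed \<theta> in simp)
  then have len: "curve_length g \<gamma> = \<theta> / H" by (simp add: \<sigma>'(2))
  have "integral {0..1} (\<lambda>s. B (\<sigma>' s) (\<sigma>' s)) = integral {0..1} (\<lambda>s::real. \<theta>\<^sup>2)"
    by (intro Henstock_Kurzweil_Integration.integral_cong) (use speed in simp)
  then have en: "curve_energy g \<gamma> = 1/2 * (\<theta>\<^sup>2 / H\<^sup>2)" by (simp add: \<sigma>'(3))
  have crit: "((\<lambda>e. curve_energy g (\<Gamma> e)) has_real_derivative 0) (at 0)"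
    if "proper_variation I \<gamma> \<Gamma>" for \<Gamma>
  proof -
    from that obtain \<delta> W where \<delta>: "\<delta> > 0" and W: "open W" "{-\<delta><..<\<delta>} \<times> {0..1} \<subseteq> W"
      and sm: "smooth_on W (\<lambda>(e, s). \<Gamma> e s)"
      and \<Gamma>I: "\<And>e s. e \<in> {-\<delta><..<\<delta>} \<Longrightarrow> s \<in> {0..1} \<Longrightarrow> \<Gamma> e s \<in> I"
      and \<Gamma>ends: "\<And>e. e \<in> {-\<delta><..<\<delta>} \<Longrightarrow> \<Gamma> e 0 = p \<and> \<Gamma> e 1 = q"
      and \<Gamma>0: "\<And>s. s \<in> {0..1} \<Longrightarrow> \<Gamma> 0 s = \<gamma> s"
      unfolding proper_variation_def ends by blast
    have C\<Gamma>: "C_k_on k (\<lambda>(e, s). \<Gamma> e s) W" for k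
      using sm by (simp add: smooth_on_def)
    obtain D where D: "((\<lambda>e. curve_energy g (\<Gamma> e)) has_real_derivative D) (at 0)"
      using energy_differentiable[OF \<delta> W C\<Gamma> \<Gamma>I] by blast
    \<comment> \<open>\<open>\<Gamma> 0\<close> is known to agree with \<gamma> on [0,1] only, so
      the two-sided derivatives may differ at the end points; these form a null set.\<close>
    have "curve_energy g (\<Gamma> 0) = curve_energy g \<gamma>"
      unfolding curve_energy_def
    proof (intro arg_cong[where f = "\<lambda>x. 1/2 * x"] integral_spike[of "{0, 1}"])
      fix s :: real assume "s \<in> {0..1} - {0, 1}"
      then have s: "s \<in> {0<..<1}" by auto
      then have "\<forall>\<^sub>F r in nhds s. r \<in> UNIV \<longrightarrow> \<gamma> r = \<Gamma> 0 r"
        unfolding eventually_nhds using \<Gamma>0 by (intro exI[of _ "{0<..<1}"]) auto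
      from vector_derivative_cong_eq[OF this refl refl] have "vector_derivative \<gamma> (at s) = vector_derivative (\<Gamma> 0) (at s)"
        by simp
      then show "(let w = vector_derivative \<gamma> (at s) in \<Sum>i\<in>UNIV. \<Sum>j\<in>UNIV. g (\<gamma> s) $ i $ j * w $ i * w $ j) =
        (let w = vector_derivative (\<Gamma> 0) (at s) in \<Sum>i\<in>UNIV. \<Sum>j\<in>UNIV. g (\<Gamma> 0 s) $ i $ j * w $ i * w $ j)"
        using s \<Gamma>0 by simp
    qed auto
    then have "curve_energy g (\<Gamma> 0) \<le> curve_energy g (\<Gamma> e)" if "\<bar>0 - e\<bar> < \<delta>" for e
    proof -
      assume 0: "curve_energy g (\<Gamma> 0) = curve_energy g \<gamma>"
      have e: "e \<in> {-\<delta><..<\<delta>}" using that by auto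
      \<comment> \<open>The slice of \<open>W\<close> at \<open>e\<close> is the open neighbourhood
        of [0,1] on which \<open>\<Gamma> e\<close> is regular, as the energy bound
        requires.\<close>
      have "open (Pair e -` W)"
        using W(1) by (intro open_vimage continuous_intros)
      moreover have "(e, s) \<in> W" if "s \<in> {0..1}" for s
        by (rule subsetD[OF W(2)]) (use e that in simp)
      then have "{0..1} \<subseteq> Pair e -` W" by blast
      ultimately have V: "open (Pair e -` W)" "{0..1} \<subseteq> Pair e -` W" .
      have "C_k_on 1 (\<Gamma> e) (Pair e -` W)"
        using C_k_on_slice[OF C\<Gamma>[of 1] V(1), of e] by simp
      from arc_energy_ge[OF V this \<Gamma>I[OF e]] show ?thesis
        using \<Gamma>ends[OF e] by (simp add: 0 en \<theta>_def)
    qed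
    with D have "D = 0" by (intro DERIV_local_min[OF D \<delta>]) blast
    with D show ?thesis by simp
  qed
  have "geodesic_arc g I p q \<gamma>" unfolding geodesic_arc_def using arc crit by blast
  \<comment> \<open>Every competing geodesic arc is a smooth arc, so the length bound
    \<open>ge\<close> applies to it.\<close>
  then have "shortest_geodesic_arc g I p q \<gamma>"
    unfolding shortest_geodesic_arc_def using ge len geodesic_arc_def by metis
  then show ?thesis using len by (intro that) (auto simp: \<theta>_def)
qed

end

section \<open>Tangent vectors in a chart\<close>

lemma is_chart_inj_on:
  assumes "is_chart M c"
  shows "inj_on (snd c) (fst c)"
proof -
  have "topspace (subtopology M (fst c)) = fst c"
    using assms openin_subset[of M "fst c"] by (auto simp: is_chart_def topspace_subtopology)
  then show ?thesis
    using assms homeomorphic_imp_injective_map unfolding is_chart_def by metis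
qed

lemma is_chart_open_image:
  assumes "is_chart M c" "openin M U" "U \<subseteq> fst c"
  shows "open (snd c ` U)"
proof -
  have "openin (subtopology M (fst c)) U"
    using assms by (simp add: is_chart_def openin_open_subtopology)
  then have "openin (subtopology euclidean (snd c ` fst c)) (snd c ` U)"
    using assms homeomorphic_imp_open_map unfolding is_chart_def open_map_def by blast
  moreover have "open (snd c ` fst c)" using assms(1) by (simp add: is_chart_def)
  ultimately show ?thesis by (simp add: openin_open_eq)
qed

locale chart_at =
  fixes M :: "'m topology"
    and A :: "('m, 'n::finite) chart set"
    and c :: "('m, 'n) chart"
    and x :: 'm
  assumes manifold: "smooth_manifold M A"
    and c: "c \<in> A" "x \<in> fst c"
begin

lemma chart: "d \<in> A \<Longrightarrow> is_chart M d"
  using manifold by (simp add: smooth_manifold_def)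

lemma chart_inv_snd: "d \<in> A \<Longrightarrow> z \<in> fst d \<Longrightarrow> chart_inv d (snd d z) = z"
  using is_chart_inj_on[OF chart] by (simp add: chart_inv_def)

lemma x_topspace: "x \<in> topspace M"
  using chart[OF c(1)] c(2) openin_subset unfolding is_chart_def by blast

definition transition :: "('m, 'n) chart \<Rightarrow> ('m, 'n) chart \<Rightarrow> real^'n \<Rightarrow> real^'n" where
  "transition d e = frechet_derivative (snd e \<circ> chart_inv d) (at (snd d x))"

lemma transition_has_derivative:
  assumes "d \<in> A" "e \<in> A" "x \<in> fst d" "x \<in> fst e"
  shows "(snd e \<circ> chart_inv d has_derivative transition d e) (at (snd d x))"
proof -
  have "C_k_on (Suc 0) (snd e \<circ> chart_inv d) (snd d ` (fst d \<inter> fst e))"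
    using manifold assms(1,2) by (simp add: smooth_manifold_def smooth_on_def del: C_k_on.simps)
  then show ?thesis
    unfolding transition_def using assms by (auto intro!: has_derivative_frechet)
qed

text \<open>\<open>snd c \<circ> chart_inv c\<close> is known to be the identity on the image of the
  chart, which is open and so determines the derivative.\<close>

lemma transition_self: "transition c c = (\<lambda>y. y)"
proof -
  have "(snd c \<circ> chart_inv c has_derivative (\<lambda>y. y)) (at (snd c x))"
  proof (rule has_derivative_transform_within_open[OF has_derivative_ident])
    show "open (snd c ` fst c)" using chart[OF c(1)] by (simp add: is_chart_def)
  qed (use c in \<open>auto simp: chart_inv_snd\<close>)
  from frechet_derivative_at[OF this] show ?thesis by (simp add: transition_def)
qed

text \<open>The chain rule near \<open>snd c x\<close>, where \<open>chart_inv d\<close> cancels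
  \<open>snd d\<close> on the overlap of the domains, whose image is open. It is the reason why
  \<open>tvec_of\<close> obeys the contravariant transformation law.\<close>

lemma transition_cocycle:
  assumes "d \<in> A" "e \<in> A" "x \<in> fst d" "x \<in> fst e"
  shows "transition c e y = transition d e (transition c d y)"
proof -
  let ?U = "fst c \<inter> fst d"
  have 1: "(snd d \<circ> chart_inv c has_derivative transition c d) (at (snd c x))"
    using assms c by (intro transition_has_derivative) auto
  have "(snd e \<circ> chart_inv d has_derivative transition d e) (at ((snd d \<circ> chart_inv c) (snd c x)))"
    using transition_has_derivative[OF assms] c by (simp add: chart_inv_snd)
  from diff_chain_at[OF 1 this]
  have "(snd e \<circ> chart_inv c has_derivative transition d e \<circ> transition c d) (at (snd c x))"
  proof (rule has_derivative_transform_within_open)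
    show "open (snd c ` ?U)"
      using chart[OF c(1)] chart[OF assms(1)] by (intro is_chart_open_image[of M]) (auto simp: is_chart_def)
    show "snd c x \<in> snd c ` ?U" using c(2) assms(3) by blast
    fix u assume "u \<in> snd c ` ?U"
    then obtain z where "z \<in> fst c" "z \<in> fst d" "u = snd c z" by blast
    then show "(snd e \<circ> chart_inv d \<circ> (snd d \<circ> chart_inv c)) u = (snd e \<circ> chart_inv c) u"
      using c(1) assms(1) by (simp add: chart_inv_snd)
  qed
  from fun_cong[OF frechet_derivative_at[OF this], of y] show ?thesis
    by (simp add: transition_def[of c e])
qed

section \<open>Components of tangent vectors in the fixed chart\<close>

abbreviation tv :: "real^'n \<Rightarrow> ('m, 'n) tvec" where
  "tv \<equiv> tvec_of A c x"

lemma tv_apply: "tv y d = (if d \<in> A \<and> x \<in> fst d then transition c d y else 0)"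
  by (simp add: tvec_of_def transition_def)

lemma tv_self: "tv y c = y"
  using c by (simp add: tv_apply transition_self)

lemma tv_tangent: "tv y \<in> tangent_space A x"
proof -
  have "tv y e = frechet_derivative (snd e \<circ> chart_inv d) (at (snd d x)) (tv y d)"
    if "d \<in> A" "e \<in> A" "x \<in> fst d" "x \<in> fst e" for d e
    using transition_cocycle[OF that, of y] that
    by (simp only: tv_apply simp_thms if_True transition_def[of d e])
  moreover have "tv y d = 0" if "\<not> (d \<in> A \<and> x \<in> fst d)" for d
    using that by (auto simp: tv_apply)
  ultimately show ?thesis unfolding tangent_space_def by blast
qed

text \<open>The transformation law from \<open>c\<close> to \<open>d\<close> recovers the whole
  family of components from its member at \<open>c\<close>; on all other arguments both sides vanish
  by convention.\<close>

lemma tv_coord: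
  assumes "v \<in> tangent_space A x"
  shows "tv (v c) = v"
proof
  fix d
  note v = assms[unfolded tangent_space_def mem_Collect_eq]
  show "tv (v c) d = v d"
  proof (cases "d \<in> A \<and> x \<in> fst d")
    case True
    then have "v d = transition c d (v c)"
      unfolding transition_def using conjunct1[OF v, rule_format, OF c(1) _ c(2)] by (elim conjE)
    with True show ?thesis by (simp only: tv_apply simp_thms if_True)
  next
    case False
    then have "v d = 0" by (rule conjunct2[OF v, rule_format])
    with False show ?thesis by (simp only: tv_apply if_False)
  qed
qed

lemma tv_scale: "tv (k *\<^sub>R y) = tvec_scale k (tv y)"
proof
  fix d
  have "transition c d (k *\<^sub>R y) = k *\<^sub>R transition c d y" if "d \<in> A" "x \<in> fst d"
    by (rule linear_scale[OF has_derivative_linear[OF transition_has_derivative[OF c(1) that(1) c(2) that(2)]]])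
  then show "tv (k *\<^sub>R y) d = tvec_scale k (tv y) d"
    by (simp add: tv_apply tvec_scale_def)
qed

lemma tv_zero: "tv 0 = tvec_zero"
proof -
  have "tv (0 *\<^sub>R 0) = tvec_scale 0 (tv 0)" by (rule tv_scale)
  also have "\<dots> = tvec_zero" unfolding tvec_scale_def tvec_zero_def by (simp only: scaleR_zero_left)
  finally show ?thesis by (simp only: scaleR_zero_left)
qed

lemma tv_nonzero:
  assumes "y \<noteq> 0"
  shows "tv y \<in> nonzero_tangent A x"
proof -
  have "tv y \<noteq> tvec_zero"
    using assms tv_self[of y] by (metis tvec_zero_def)
  then show ?thesis using tv_tangent by (simp add: nonzero_tangent_def)
qed

lemma nonzero_tangentD: "v \<in> nonzero_tangent A x \<Longrightarrow> tv (v c) = v"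
  unfolding nonzero_tangent_def by (blast intro: tv_coord)

lemma coord_nonzero:
  assumes "v \<in> nonzero_tangent A x"
  shows "v c \<noteq> 0"
proof
  assume "v c = 0"
  then have "v = tvec_zero" using nonzero_tangentD[OF assms] tv_zero by metis
  with assms show False unfolding nonzero_tangent_def by blast
qed

lemma tv_bij: "bij_betw tv (-{0}) (nonzero_tangent A x)"
proof (rule bij_betw_byWitness[where f' = "\<lambda>v. v c"])
  show "\<forall>y\<in>-{0}. tv y c = y" using tv_self by blast
  show "\<forall>v\<in>nonzero_tangent A x. tv (v c) = v" using nonzero_tangentD by blast
  show "tv ` (-{0}) \<subseteq> nonzero_tangent A x" using tv_nonzero by blast
  show "(\<lambda>v. v c) ` nonzero_tangent A x \<subseteq> -{0}" by (intro image_subsetI ComplI) (simp add: coord_nonzero)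
qed

text \<open>Joint smoothness in base point and vector restricts to the fibre over \<open>x\<close>,
  which is the slice at \<open>snd c x\<close>.\<close>

lemma smooth_on_fibre:
  assumes "smooth_on ((snd c ` fst c) \<times> (-{0})) (\<lambda>(u, y). f (chart_inv c u) (tvec_of A c (chart_inv c u) y))"
  shows "smooth_on (-{0}) (\<lambda>y. f x (tv y))"
  unfolding smooth_on_def
proof
  fix k
  have "C_k_on k (\<lambda>(u, y). f (chart_inv c u) (tvec_of A c (chart_inv c u) y)) ((snd c ` fst c) \<times> (-{0}))"
    using assms by (simp add: smooth_on_def)
  from C_k_on_slice[OF this, of "-{0}" "snd c x"] show "C_k_on k (\<lambda>y. f x (tv y)) (-{0})"
    using c by (simp add: chart_inv_snd open_Compl)
qed

end

section \<open>Homogeneous functions\<close>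

text \<open>Differentiate \<open>k \<mapsto> h (k y)\<close> at \<open>k = 1\<close> once by the
  chain rule and once by homogeneity. The weight \<phi> is kept general to cover \<open>k\<close>,
  \<open>k\<^sup>2\<close> and \<open>k powr H\<close>.\<close>

lemma Euler_homogeneous:
  fixes h :: "'a::real_normed_vector \<Rightarrow> 'b::real_normed_vector"
  assumes h: "(h has_derivative D) (at y)"
    and hom: "\<And>k. k > 0 \<Longrightarrow> h (k *\<^sub>R y) = \<phi> k *\<^sub>R h y"
    and \<phi>: "(\<phi> has_real_derivative m) (at 1)"
  shows "D y = m *\<^sub>R h y"
proof -
  have 1: "((\<lambda>k. k *\<^sub>R y) has_derivative (\<lambda>r. r *\<^sub>R y)) (at (1::real))"
    by (auto intro!: derivative_eq_intros)
  have "((\<lambda>k. h (k *\<^sub>R y)) has_derivative (\<lambda>r. D (r *\<^sub>R y))) (at 1)"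
    using has_derivative_compose[OF 1, of h D] h by simp
  moreover have "((\<lambda>k. h (k *\<^sub>R y)) has_derivative (\<lambda>r. (m * r) *\<^sub>R h y)) (at 1)"
  proof (rule has_derivative_transform_within_open[of _ _ _ _ "{0<..}"])
    show "((\<lambda>k. \<phi> k *\<^sub>R h y) has_derivative (\<lambda>r. (m * r) *\<^sub>R h y)) (at 1)"
      using \<phi> by (auto intro!: derivative_eq_intros simp: has_field_derivative_def)
  qed (auto simp: hom)
  ultimately have "(\<lambda>r. D (r *\<^sub>R y)) = (\<lambda>r. (m * r) *\<^sub>R h y)"
    by (rule has_derivative_unique)
  from fun_cong[OF this, of 1] show ?thesis by simp
qed

lemma linear_eq_sum_axis:
  fixes L :: "real^'n::finite \<Rightarrow> real"
  assumes "linear L"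
  shows "L w = (\<Sum>i\<in>UNIV. w $ i * L (axis i 1))"
proof -
  have "L w = L (\<Sum>i\<in>UNIV. (w $ i) *\<^sub>R axis i 1)"
    using basis_expansion[of w] by (simp add: scalar_mult_eq_scaleR)
  then show ?thesis by (simp add: linear_sum[OF assms] linear_scale[OF assms])
qed

text \<open>Euler's theorem twice: the first partial derivatives have degree 1, so contracting the
  Hessian once with \<open>y\<close> returns them; the second contraction gives \<open>2 f\<close>,
  and the factor 1/2 removes the 2.\<close>

lemma Hessian_homogeneous:
  fixes f :: "real^'n::finite \<Rightarrow> real"
  assumes f: "C_k_on 2 f (-{0})" and y: "y \<noteq> 0"
    and hom: "\<And>k z. k > 0 \<Longrightarrow> z \<noteq> 0 \<Longrightarrow> f (k *\<^sub>R z) = k\<^sup>2 * f z"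
  shows "(\<Sum>i\<in>UNIV. \<Sum>j\<in>UNIV. 1/2 * partial_deriv i (partial_deriv j f) y * y $ i * y $ j) = f y"
proof -
  let ?D = "\<lambda>z. frechet_derivative f (at z)"
  have d: "(f has_derivative ?D z) (at z)" if "z \<noteq> 0" for z
    using f that by (auto simp: numeral_2_eq_2 intro: has_derivative_frechet)
  \<comment> \<open>Differentiating \<open>f (k z) = k\<^sup>2 f z\<close> in \<open>z\<close>
    produces a factor \<open>k\<close> on the left, which is then cancelled.\<close>
  have D_hom: "?D (k *\<^sub>R z) v = k * ?D z v" if k: "k > 0" and z: "z \<noteq> 0" for k z v
  proof -
    have "((\<lambda>z. k *\<^sub>R z) has_derivative (\<lambda>v. k *\<^sub>R v)) (at z)"
      by (auto intro!: derivative_eq_intros)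
    from has_derivative_compose[OF this d]
    have "((\<lambda>z. f (k *\<^sub>R z)) has_derivative (\<lambda>v. ?D (k *\<^sub>R z) (k *\<^sub>R v))) (at z)"
      using k z by simp
    moreover have "((\<lambda>z. f (k *\<^sub>R z)) has_derivative (\<lambda>v. k\<^sup>2 * ?D z v)) (at z)"
    proof (rule has_derivative_transform_within_open[of _ _ _ _ "-{0}"])
      show "((\<lambda>z. k\<^sup>2 * f z) has_derivative (\<lambda>v. k\<^sup>2 * ?D z v)) (at z)"
        by (rule has_derivative_mult_right[OF d[OF z]])
    qed (use k z hom in auto)
    ultimately have "(\<lambda>v. ?D (k *\<^sub>R z) (k *\<^sub>R v)) = (\<lambda>v. k\<^sup>2 * ?D z v)"
      by (rule has_derivative_unique)
    from fun_cong[OF this, of v] have "k * ?D (k *\<^sub>R z) v = k\<^sup>2 * ?D z v"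
      using linear_scale[OF has_derivative_linear[OF d[of "k *\<^sub>R z"]], of k v] k z by simp
    then show ?thesis using k by (simp add: power2_eq_square)
  qed
  have inner: "(\<Sum>i\<in>UNIV. y $ i * partial_deriv i (partial_deriv j f) y) = partial_deriv j f y" for j
  proof -
    have pd: "(partial_deriv j f has_derivative frechet_derivative (partial_deriv j f) (at y)) (at y)"
    proof (rule has_derivative_frechet)
      show "partial_deriv j f differentiable (at y)"
        using f y by (auto simp: numeral_2_eq_2 partial_deriv_def[abs_def])
    qed
    have "frechet_derivative (partial_deriv j f) (at y) y = 1 *\<^sub>R partial_deriv j f y"
      by (rule Euler_homogeneous[OF pd, where \<phi> = "\<lambda>k. k"])
        (auto simp: partial_deriv_def D_hom y)
    then show ?thesis
      using linear_eq_sum_axis[OF has_derivative_linear[OF pd], of y]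
      by (simp add: partial_deriv_def[of _ "partial_deriv j f"])
  qed
  have outer: "(\<Sum>j\<in>UNIV. y $ j * partial_deriv j f y) = 2 * f y"
  proof -
    have "?D y y = 2 *\<^sub>R f y"
      by (rule Euler_homogeneous[OF d[OF y], where \<phi> = "\<lambda>k. k\<^sup>2"])
        (auto simp: hom y intro!: derivative_eq_intros)
    then show ?thesis
      using linear_eq_sum_axis[OF has_derivative_linear[OF d[OF y]], of y] by (simp add: partial_deriv_def)
  qed
  have "(\<Sum>i\<in>UNIV. \<Sum>j\<in>UNIV. 1/2 * partial_deriv i (partial_deriv j f) y * y $ i * y $ j) =
    (\<Sum>j\<in>UNIV. 1/2 * y $ j * (\<Sum>i\<in>UNIV. y $ i * partial_deriv i (partial_deriv j f) y))"
    by (subst sum.swap) (simp add: sum_distrib_left mult_ac)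
  also have "\<dots> = 1/2 * (\<Sum>j\<in>UNIV. y $ j * partial_deriv j f y)"
    by (simp add: inner sum_distrib_left mult_ac)
  finally show ?thesis by (simp add: outer)
qed

text \<open>The quadratic form of \<open>J\<^sup>T C J\<close> at \<open>w\<close> is that of
  \<open>C\<close> at \<open>J w\<close>; all the work lies in reordering a fourfold sum.\<close>

lemma quadratic_form_pullback:
  fixes C J :: "real^'n::finite^'n"
  shows "(\<Sum>m\<in>UNIV. \<Sum>n\<in>UNIV. (\<Sum>i\<in>UNIV. \<Sum>j\<in>UNIV. C $ i $ j * J $ i $ m * J $ j $ n) * w $ m * w $ n) =
    (\<Sum>i\<in>UNIV. \<Sum>j\<in>UNIV. C $ i $ j * (J *v w) $ i * (J *v w) $ j)"
proof -
  let ?t = "\<lambda>m n i j. C $ i $ j * (J $ i $ m * w $ m) * (J $ j $ n * w $ n)"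
  have "c * (\<Sum>m\<in>UNIV. a m) * (\<Sum>n\<in>UNIV. b n) = (\<Sum>m\<in>UNIV. \<Sum>n\<in>UNIV. c * a m * b n)"
    for c :: real and a b :: "'n \<Rightarrow> real"
    by (simp only: sum_distrib_left[of c] sum_product)
  then have "(\<Sum>i\<in>UNIV. \<Sum>j\<in>UNIV. C $ i $ j * (J *v w) $ i * (J *v w) $ j) =
    (\<Sum>i\<in>UNIV. \<Sum>j\<in>UNIV. \<Sum>m\<in>UNIV. \<Sum>n\<in>UNIV. ?t m n i j)"
    by (simp only: matrix_vector_mult_def vec_lambda_beta)
  also have "\<dots> = (\<Sum>i\<in>UNIV. \<Sum>m\<in>UNIV. \<Sum>j\<in>UNIV. \<Sum>n\<in>UNIV. ?t m n i j)"
    by (rule sum.cong[OF refl], rule sum.swap)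
  also have "\<dots> = (\<Sum>m\<in>UNIV. \<Sum>i\<in>UNIV. \<Sum>j\<in>UNIV. \<Sum>n\<in>UNIV. ?t m n i j)"
    by (rule sum.swap)
  also have "\<dots> = (\<Sum>m\<in>UNIV. \<Sum>i\<in>UNIV. \<Sum>n\<in>UNIV. \<Sum>j\<in>UNIV. ?t m n i j)"
    by (rule sum.cong[OF refl], rule sum.cong[OF refl], rule sum.swap)
  also have "\<dots> = (\<Sum>m\<in>UNIV. \<Sum>n\<in>UNIV. \<Sum>i\<in>UNIV. \<Sum>j\<in>UNIV. ?t m n i j)"
    by (rule sum.cong[OF refl], rule sum.swap)
  finally show ?thesis by (simp only: sum_distrib_right) (simp add: mult_ac)
qed

section \<open>The Finslerian angle\<close>

locale conformal_automorphism = chart_at M A c x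
  for M :: "'m topology" and A :: "('m, 'n::finite) chart set" and c x +
  fixes F :: "'m \<Rightarrow> ('m, 'n) tvec \<Rightarrow> real"
    and a :: "'m \<Rightarrow> ('m, 'n) tvec \<Rightarrow> ('m, 'n) tvec \<Rightarrow> real"
    and H :: "'m \<Rightarrow> real"
    and t :: "'m \<Rightarrow> ('m, 'n) tvec \<Rightarrow> ('m, 'n) tvec"
  assumes finsler: "finsler_metric M A F"
    and riemannian: "riemannian_metric M A a"
    and conformal: "conformally_automorphic M A F a H t"
begin

definition B :: "real^'n \<Rightarrow> real^'n \<Rightarrow> real" where
  "B u v = a x (tv u) (tv v)"

definition T :: "real^'n \<Rightarrow> real^'n" where
  "T y = t x (tv y) c"

section \<open>The Riemannian metric at \<open>x\<close> in the chart\<close>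

lemma B_eq_sum: "B u v = (\<Sum>i\<in>UNIV. \<Sum>j\<in>UNIV. metric_comp A a c x $ i $ j * u $ i * v $ j)"
proof -
  have "\<forall>v\<in>tangent_space A x. \<forall>w\<in>tangent_space A x.
        a x v w = (\<Sum>i\<in>UNIV. \<Sum>j\<in>UNIV. metric_comp A a c x $ i $ j * v c $ i * w c $ j)"
    using riemannian c unfolding riemannian_metric_def by blast
  from this[rule_format, OF tv_tangent tv_tangent] show ?thesis
    by (simp only: B_def tv_self)
qed

lemma B_coord: "v \<in> tangent_space A x \<Longrightarrow> w \<in> tangent_space A x \<Longrightarrow> B (v c) (w c) = a x v w"
  by (simp add: B_def tv_coord)

lemma inner_form_B: "inner_form B"
proof (rule inner_form.intro)
  have "bilinear B"
    unfolding bilinear_def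
    by (auto intro!: linearI simp: B_eq_sum algebra_simps sum.distrib sum_distrib_left)
  then show "bounded_bilinear B" by (simp add: bilinear_conv_bounded_bilinear)
  fix u v
  show "B u v = B v u"
    using riemannian x_topspace tv_tangent unfolding riemannian_metric_def B_def by blast
next
  fix u :: "real^'n" assume "u \<noteq> 0"
  then show "B u u > 0"
    using riemannian x_topspace tv_nonzero unfolding riemannian_metric_def B_def by blast
qed

sublocale inner_form B by (rule inner_form_B)

section \<open>The transformation at \<open>x\<close> in the chart\<close>

lemma H_pos: "H x > 0"
  using conformal x_topspace unfolding conformally_automorphic_def by blast

lemma t_bij: "bij_betw (t x) (nonzero_tangent A x) (nonzero_tangent A x)"
  using conformal x_topspace unfolding conformally_automorphic_def by blast

lemma t_nonzero: "v \<in> nonzero_tangent A x \<Longrightarrow> t x v \<in> nonzero_tangent A x"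
  using t_bij by (auto simp: bij_betw_def)

lemma t_tv: "y \<noteq> 0 \<Longrightarrow> t x (tv y) = tv (T y)"
  unfolding T_def by (rule nonzero_tangentD[symmetric]) (intro t_nonzero tv_nonzero)

lemma t_homogeneous:
  "v \<in> nonzero_tangent A x \<Longrightarrow> k > 0 \<Longrightarrow> t x (tvec_scale k v) = tvec_scale (k powr H x) (t x v)"
  using conformal x_topspace unfolding conformally_automorphic_def by blast

lemma T_homogeneous: "y \<noteq> 0 \<Longrightarrow> k > 0 \<Longrightarrow> T (k *\<^sub>R y) = (k powr H x) *\<^sub>R T y"
  unfolding T_def tv_scale by (simp add: t_homogeneous tv_nonzero) (simp add: tvec_scale_def)

lemma T_smooth: "smooth_on (-{0}) T"
proof -
  have "smooth_on ((snd c ` fst c) \<times> (-{0})) (\<lambda>(u, y). t (chart_inv c u) (tvec_of A c (chart_inv c u) y) c)"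
    using conformal c unfolding conformally_automorphic_def by blast
  from smooth_on_fibre[of "\<lambda>x v. t x v c", OF this] show ?thesis
    by (simp add: T_def[abs_def])
qed

lemma T_bij: "bij_betw T (-{0}) (-{0})"
proof -
  have "bij_betw (\<lambda>v. v c) (nonzero_tangent A x) (-{0})"
    by (rule bij_betw_byWitness[where f' = tv])
      (use tv_self tv_nonzero coord_nonzero nonzero_tangentD in \<open>auto simp: image_subset_iff\<close>)
  from bij_betw_trans[OF bij_betw_trans[OF tv_bij t_bij] this] show ?thesis
    by (simp add: T_def[abs_def] comp_def)
qed

lemma T_has_derivative: "y \<noteq> 0 \<Longrightarrow> (T has_derivative frechet_derivative T (at y)) (at y)"
  using T_smooth[unfolded smooth_on_def, rule_format, of "Suc 0"] by (auto intro: has_derivative_frechet)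

section \<open>The Finsler tensor at \<open>x\<close> in the chart\<close>

lemma finsler_pos: "v \<in> nonzero_tangent A x \<Longrightarrow> F x v > 0"
  using finsler x_topspace unfolding finsler_metric_def by blast

lemma finsler_homogeneous: "v \<in> nonzero_tangent A x \<Longrightarrow> k > 0 \<Longrightarrow> F x (tvec_scale k v) = k * F x v"
  using finsler x_topspace unfolding finsler_metric_def by blast

lemma finsler_tensor_pos:
  "y \<noteq> 0 \<Longrightarrow> w \<noteq> 0 \<Longrightarrow>
    (\<Sum>i\<in>UNIV. \<Sum>j\<in>UNIV. finsler_tensor A F c x y $ i $ j * w $ i * w $ j) > 0"
  using finsler c unfolding finsler_metric_def by blast

lemma finsler_tensor_Euler:
  assumes "y \<noteq> 0"
  shows "(\<Sum>i\<in>UNIV. \<Sum>j\<in>UNIV. finsler_tensor A F c x y $ i $ j * y $ i * y $ j) = (F x (tv y))\<^sup>2"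
proof -
  have "smooth_on ((snd c ` fst c) \<times> (-{0})) (\<lambda>(u, y). F (chart_inv c u) (tvec_of A c (chart_inv c u) y))"
    using finsler c unfolding finsler_metric_def by blast
  then have "C_k_on 2 (\<lambda>y. F x (tv y)) (-{0})"
    using smooth_on_fibre unfolding smooth_on_def by blast
  then have "C_k_on 2 (\<lambda>y. F x (tv y) * F x (tv y)) (-{0})"
    by (intro C_k_on_mult) auto
  then have "C_k_on 2 (\<lambda>y. (F x (tv y))\<^sup>2) (-{0})"
    by (simp only: power2_eq_square)
  from Hessian_homogeneous[OF this assms] show ?thesis
    by (simp add: finsler_tensor_def tv_scale finsler_homogeneous tv_nonzero power_mult_distrib)
qed

text \<open>Condition (iii) contracted with \<open>w\<close> in both slots; the Jacobian matrix
  thereby turns into the differential of \<open>T\<close>.\<close>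

lemma finsler_tensor_conformal:
  obtains p where "\<And>y w. y \<noteq> 0 \<Longrightarrow>
    (\<Sum>i\<in>UNIV. \<Sum>j\<in>UNIV. finsler_tensor A F c x y $ i $ j * w $ i * w $ j) =
      (p y)\<^sup>2 * B (frechet_derivative T (at y) w) (frechet_derivative T (at y) w)"
proof -
  obtain p :: "'m \<Rightarrow> ('m, 'n) tvec \<Rightarrow> real" where p: "\<forall>c\<in>A. \<forall>x\<in>fst c. \<forall>y. y \<noteq> 0 \<longrightarrow>
           (let J = jacobian (\<lambda>z. t x (tvec_of A c x z) c) (at y) in
            \<forall>m n. finsler_tensor A F c x y $ m $ n =
              (p x (tvec_of A c x y))\<^sup>2 *
              (\<Sum>i\<in>UNIV. \<Sum>j\<in>UNIV. metric_comp A a c x $ i $ j * J $ i $ m * J $ j $ n))"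
    using conformal unfolding conformally_automorphic_def by (elim conjE exE) blast
  have "(\<Sum>m\<in>UNIV. \<Sum>n\<in>UNIV. finsler_tensor A F c x y $ m $ n * w $ m * w $ n) =
      (p x (tv y))\<^sup>2 * B (frechet_derivative T (at y) w) (frechet_derivative T (at y) w)"
    if y: "y \<noteq> 0" for y w
  proof -
    define J where "J = jacobian T (at y)"
    have Jw: "J *v w = frechet_derivative T (at y) w"
      using has_derivative_linear[OF T_has_derivative[OF y]]
      by (simp add: J_def jacobian_def matrix_works linear_matrix_vector_mul_eq)
    define Q where "Q m n = (\<Sum>i\<in>UNIV. \<Sum>j\<in>UNIV. metric_comp A a c x $ i $ j * J $ i $ m * J $ j $ n)" for m n
    have "finsler_tensor A F c x y $ m $ n = (p x (tv y))\<^sup>2 * Q m n" for m n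
      using p[rule_format, OF c y] unfolding Q_def J_def T_def[abs_def] Let_def by blast
    then have "(\<Sum>m\<in>UNIV. \<Sum>n\<in>UNIV. finsler_tensor A F c x y $ m $ n * w $ m * w $ n) =
      (p x (tv y))\<^sup>2 * (\<Sum>m\<in>UNIV. \<Sum>n\<in>UNIV. Q m n * w $ m * w $ n)"
      by (simp add: sum_distrib_left mult.assoc)
    then show ?thesis
      by (simp only: Q_def quadratic_form_pullback B_eq_sum Jw)
  qed
  then show ?thesis by (rule that)
qed

lemma indicatrix_iff: "y \<in> indicatrix A F c x \<longleftrightarrow> y \<noteq> 0 \<and> B (T y) (T y) = 1"
proof (cases "y = 0")
  case False
  have "F x (tv y) = 1 \<longleftrightarrow> riemannian_norm a x (t x (tv y)) = 1"
    using conformal x_topspace tv_nonzero[OF False] unfolding conformally_automorphic_def by blast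
  then show ?thesis
    using False by (simp add: indicatrix_def riemannian_norm_def t_tv B_def)
qed (simp add: indicatrix_def)

lemma T_Euler:
  assumes "y \<noteq> 0"
  shows "frechet_derivative T (at y) y = H x *\<^sub>R T y"
proof (rule Euler_homogeneous[OF T_has_derivative[OF assms], where \<phi> = "\<lambda>k. k powr H x"])
  show "((\<lambda>k. k powr H x) has_real_derivative H x) (at 1)"
    by (auto intro!: derivative_eq_intros)
qed (use assms T_homogeneous in auto)

lemma homothetic_sphere_indicatrix:
  "homothetic_sphere B T (H x) (finsler_tensor A F c x) (indicatrix A F c x)"
proof -
  obtain p where p: "\<And>y w. y \<noteq> 0 \<Longrightarrow>
    (\<Sum>i\<in>UNIV. \<Sum>j\<in>UNIV. finsler_tensor A F c x y $ i $ j * w $ i * w $ j) =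
      (p y)\<^sup>2 * B (frechet_derivative T (at y) w) (frechet_derivative T (at y) w)"
    using finsler_tensor_conformal by blast
  show ?thesis
  proof
    fix y w :: "real^'n" assume "y \<noteq> 0" "w \<noteq> 0"
    \<comment> \<open>A vector annihilated by the differential of \<open>T\<close> would satisfy
      \<open>g(w,w) = 0\<close> by (iii).\<close>
    from finsler_tensor_pos[OF this] p[OF \<open>y \<noteq> 0\<close>, of w]
    show "frechet_derivative T (at y) w \<noteq> 0" by (auto simp: zero_left)
  next
    fix y w assume y: "y \<in> indicatrix A F c x"
    then have y0: "y \<noteq> 0" and Fy: "F x (tv y) = 1" and Ty: "B (T y) (T y) = 1"
      using indicatrix_iff by (auto simp: indicatrix_def)
    \<comment> \<open>Euler: \<open>1 = F\<^sup>2 = g(y,y) = p\<^sup>2 a(H t, H t) = p\<^sup>2 H\<^sup>2\<close>.\<close>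
    have "(p y)\<^sup>2 * (H x)\<^sup>2 = 1"
      using finsler_tensor_Euler[OF y0] p[OF y0, of y]
      by (simp add: T_Euler y0 scaleR_left scaleR_right Ty Fy power2_eq_square)
    then have "(p y)\<^sup>2 = 1 / (H x)\<^sup>2" using H_pos by (simp add: field_simps)
    then show "(\<Sum>i\<in>UNIV. \<Sum>j\<in>UNIV. finsler_tensor A F c x y $ i $ j * w $ i * w $ j) =
      B (frechet_derivative T (at y) w) (frechet_derivative T (at y) w) / (H x)\<^sup>2"
      by (simp add: p[OF y0])
  qed (use T_smooth T_bij H_pos indicatrix_iff in auto)
qed

text \<open>By homogeneity \<open>T\<close> sends \<open>v / F\<close> to a positive multiple of
  \<open>t\<close>, and (ii) places the image on the unit sphere; so the image is \<open>t\<close>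
  normalised, whatever the power of \<open>F\<close> involved.\<close>

lemma normalized_vector:
  assumes v: "v \<in> nonzero_tangent A x"
  shows "(1 / F x v) *\<^sub>R v c \<in> indicatrix A F c x"
    and "T ((1 / F x v) *\<^sub>R v c) = (1 / riemannian_norm a x (t x v)) *\<^sub>R t x v c"
proof -
  let ?y = "(1 / F x v) *\<^sub>R v c"
  define k where "k = (1 / F x v) powr H x"
  have F: "F x v > 0" using finsler_pos[OF v] .
  have vc: "v c \<noteq> 0" "tv (v c) = v" using coord_nonzero[OF v] nonzero_tangentD[OF v] .
  have "F x (tv ?y) = 1"
    using finsler_homogeneous[OF v, of "1 / F x v"] F by (simp add: tv_scale vc)
  then show I: "?y \<in> indicatrix A F c x"
    using vc(1) F by (simp add: indicatrix_def)
  have T: "T ?y = k *\<^sub>R t x v c"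
    using T_homogeneous[OF vc(1), of "1 / F x v"] F by (simp add: k_def T_def[of "v c"] vc(2))
  have "t x v \<in> tangent_space A x" using t_nonzero[OF v] by (simp add: nonzero_tangent_def)
  then have "k\<^sup>2 * (riemannian_norm a x (t x v))\<^sup>2 = 1"
    using I T B_coord[of "t x v" "t x v"] nonneg[of "t x v c"]
    by (simp add: indicatrix_iff scaleR_left scaleR_right riemannian_norm_def power2_eq_square)
  then have "(k * riemannian_norm a x (t x v))\<^sup>2 = 1" by (simp add: power_mult_distrib)
  moreover have "k > 0" using F by (simp add: k_def)
  moreover have "riemannian_norm a x (t x v) \<ge> 0"
    using B_coord[of "t x v" "t x v"] nonneg[of "t x v c"] \<open>t x v \<in> tangent_space A x\<close>
    by (simp add: riemannian_norm_def)
  ultimately have "k * riemannian_norm a x (t x v) = 1"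
    by (smt (verit) mult_nonneg_nonneg power2_eq_1_iff)
  then have "k = 1 / riemannian_norm a x (t x v)"
    by (metis div_by_1 divide_divide_eq_right mult_zero_right nonzero_mult_div_cancel_right)
  with T show "T ?y = (1 / riemannian_norm a x (t x v)) *\<^sub>R t x v c" by simp
qed

text \<open>Two shortest arcs bound each other's length, so the one arc constructed fixes the value.
  The norms in the denominator come from \<open>normalized_vector\<close> and the bilinearity of
  \<open>B\<close>.\<close>

lemma is_finsler_angle_iff:
  assumes "CARD('n) \<ge> 2" and v: "v \<in> nonzero_tangent A x" "w \<in> nonzero_tangent A x"
  shows "is_finsler_angle A F c x v w \<alpha> \<longleftrightarrow>
    \<alpha> = 1 / H x * arccos (a x (t x v) (t x w) / (riemannian_norm a x (t x v) * riemannian_norm a x (t x w)))"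
    (is "_ \<longleftrightarrow> \<alpha> = ?\<alpha>")
proof -
  interpret hs: homothetic_sphere B T "H x" "finsler_tensor A F c x" "indicatrix A F c x"
    by (rule homothetic_sphere_indicatrix)
  obtain \<gamma> where \<gamma>: "shortest_geodesic_arc (finsler_tensor A F c x) (indicatrix A F c x)
      ((1 / F x v) *\<^sub>R v c) ((1 / F x w) *\<^sub>R w c) \<gamma>"
    "curve_length (finsler_tensor A F c x) \<gamma> =
      arccos (B (T ((1 / F x v) *\<^sub>R v c)) (T ((1 / F x w) *\<^sub>R w c))) / H x"
    using hs.exists_shortest_geodesic_arc[OF assms(1) normalized_vector(1)[OF v(1)] normalized_vector(1)[OF v(2)]] .
  have "t x v \<in> tangent_space A x" "t x w \<in> tangent_space A x"
    using t_nonzero v by (auto simp: nonzero_tangent_def)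
  then have len: "curve_length (finsler_tensor A F c x) \<gamma> = ?\<alpha>"
    by (simp add: \<gamma>(2) normalized_vector(2) v scaleR_left scaleR_right B_coord mult_ac)
  show ?thesis
    unfolding is_finsler_angle_def
  proof
    assume "\<exists>\<eta>. shortest_geodesic_arc (finsler_tensor A F c x) (indicatrix A F c x)
      ((1 / F x v) *\<^sub>R v c) ((1 / F x w) *\<^sub>R w c) \<eta> \<and> \<alpha> = curve_length (finsler_tensor A F c x) \<eta>"
    then show "\<alpha> = ?\<alpha>"
      using \<gamma>(1) unfolding shortest_geodesic_arc_def len[symmetric] by (metis order_antisym)
  qed (use \<gamma>(1) len in auto)
qed

end

text \<open>The first conjunct certifies that the definite description in
  \<open>finsler_angle\<close> denotes the length of an actual shortest geodesic arc. As the
  right-hand side does not mention \<open>c\<close>, the value is the same in every chart around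
  \<open>x\<close>.\<close>

theorem mainTheorem2:
  fixes M :: "'m topology"
    and A :: "('m, 'n::finite) chart set"
    and F :: "'m \<Rightarrow> ('m, 'n) tvec \<Rightarrow> real"
    and a :: "'m \<Rightarrow> ('m, 'n) tvec \<Rightarrow> ('m, 'n) tvec \<Rightarrow> real"
    and H :: "'m \<Rightarrow> real"
    and t :: "'m \<Rightarrow> ('m, 'n) tvec \<Rightarrow> ('m, 'n) tvec"
    and c :: "('m, 'n) chart"
    and x :: 'm
    and y1 y2 :: "('m, 'n) tvec"
  assumes "smooth_manifold M A"
    and "CARD('n) \<ge> 3"
    and "finsler_metric M A F"
    and "riemannian_metric M A a"
    and "conformally_automorphic M A F a H t"
    and "c \<in> A" and "x \<in> fst c"
    and "y1 \<in> nonzero_tangent A x" and "y2 \<in> nonzero_tangent A x"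
  shows "is_finsler_angle A F c x y1 y2 (finsler_angle A F c x y1 y2) \<and>
    finsler_angle A F c x y1 y2 =
      1 / H x * arccos (a x (t x y1) (t x y2) /
        (riemannian_norm a x (t x y1) * riemannian_norm a x (t x y2)))"
proof -
  interpret conformal_automorphism M A c x F a H t
    by unfold_locales (rule assms)+
  have "CARD('n) \<ge> 2" using assms(2) by simp
  note angle = is_finsler_angle_iff[OF this assms(8,9)]
  have "finsler_angle A F c x y1 y2 = 1 / H x * arccos (a x (t x y1) (t x y2) /
      (riemannian_norm a x (t x y1) * riemannian_norm a x (t x y2)))"
    unfolding finsler_angle_def by (rule the_equality) (simp_all only: angle)
  then show ?thesis by (simp only: angle simp_thms)
qed

end
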